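(* Let $N\ge 1$. Let $\phi:(0,\infty)\to(0,\infty)$ be a $C^1$ function and put $\Phi(t)=\int_0^{|t|}\phi(s)s\,ds$, $t\in\mathbb{R}$. Assume: $(\phi(t)t)'>0$ for all $t>0$; there exist $l,m>1$ with $l\le \frac{\phi(t)t^2}{\Phi(t)}\le m$ for all $t>0$; there exist $l_1,m_1>0$ with $l_1\le\frac{\Phi''(t)t}{\Phi'(t)}\le m_1$ for all $t>0$. Let $h(t)=\phi(t)t$. Let $a:\mathbb{R}^N\to[0,\infty)$ be a continuous radially symmetric function, $a(x)=a(|x|)$, with $$\int_1^\infty h^{-1}\Big(s^{1-N}\int_0^s t^{N-1}a(t)\,dt\Big)\,ds=\infty .$$ Let $f:[0,\infty)\to[0,\infty)$ be continuous and non-decreasing with $f(0)=0$ and $f(s)>0$ for $s>0$, and let $F(t)=\int_0^t f(s)\,ds$. Then the problem $$\Delta_\phi u=a(x)f(u)\ \text{ in }\mathbb{R}^N,\qquad u>0\ \text{ in }\mathbb{R}^N,\qquad u(x)\to\infty\ \text{ as }|x|\to\infty$$ admits a sequence of radially symmetric solutions $u_k(|x|)\in C^1(\mathbb{R}^N)$ with $u_k(0)\to\infty$ as $k\to\infty$ if and only if $\displaystyle\int_1^\infty\frac{dt}{\Phi^{-1}(F(t))}=\infty$. Besides this, $u_k'\ge 0$ in $[0,\infty)$.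
   Context: $\Delta_\phi u=\operatorname{div}(\phi(|\nabla u|)\nabla u)$. $\Phi^{-1}$ is the inverse of $\Phi$ on $[0,\infty)$; $h^{-1}$ is the inverse of $h:(0,\infty)\to(0,\infty)$, extended by $h^{-1}(0)=0$. A solution of the problem is a positive function $u\in C^1(\mathbb{R}^N)$ with $u(x)\to\infty$ as $|x|\to\infty$ and $\int_{\mathbb{R}^N} \phi(|\nabla u|)\nabla u\cdot\nabla\psi\,dx+\int_{\mathbb{R}^N} a(x)f(u)\psi\,dx=0$ for all $\psi\in C_0^\infty(\mathbb{R}^N)$ (with $\phi(|\nabla u|)\nabla u$ read as $0$ where $\nabla u=0$). *)

theory Defs
  imports "HOL-Analysis.Analysis"
begin

text \<open>The data \<open>\<phi>\<close> and \<open>h\<close> live on \<open>(0, \<infinity>)\<close>, and \<open>f\<close> on \<open>[0, \<infinity>)\<close>; they are represented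
  by total functions on the reals whose values elsewhere never matter.\<close>

definition Phi :: "(real \<Rightarrow> real) \<Rightarrow> real \<Rightarrow> real" where
  "Phi \<phi> t = integral {0..\<bar>t\<bar>} (\<lambda>s. \<phi> s * s)"

definition Phi_inv :: "(real \<Rightarrow> real) \<Rightarrow> real \<Rightarrow> real" where
  "Phi_inv \<phi> = inv_into {0..} (Phi \<phi>)"

definition h_inv :: "(real \<Rightarrow> real) \<Rightarrow> real \<Rightarrow> real" where
  "h_inv \<phi> y = (if y = 0 then 0 else inv_into {0<..} (\<lambda>t. \<phi> t * t) y)"

definition grad :: "('a::euclidean_space \<Rightarrow> real) \<Rightarrow> 'a \<Rightarrow> 'a" where
  "grad u x = (THE D. GDERIV u x :> D)"

text \<open>\<open>frechet_derivative f (at x) b\<close> is the partial derivative in the coordinate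
  direction \<open>b\<close>.\<close>

primrec Ck :: "nat \<Rightarrow> ('a::euclidean_space \<Rightarrow> real) \<Rightarrow> bool" where
  "Ck 0 f \<longleftrightarrow> continuous_on UNIV f"
| "Ck (Suc k) f \<longleftrightarrow> (\<forall>x. f differentiable (at x)) \<and>
     (\<forall>b\<in>Basis. Ck k (\<lambda>x. frechet_derivative f (at x) b))"

definition test_function :: "('a::euclidean_space \<Rightarrow> real) \<Rightarrow> bool" where
  "test_function \<psi> \<longleftrightarrow> (\<forall>k. Ck k \<psi>) \<and> compact (closure {x. \<psi> x \<noteq> 0})"

text \<open>Where \<open>grad u x = 0\<close>, the field \<open>\<phi> (norm (grad u x)) *\<^sub>R grad u x\<close> is \<open>0\<close> whatever the
  value of \<open>\<phi> 0\<close>, which is the required convention. Both integrands are continuous with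
  compact support when \<open>u\<close> is positive and \<open>C\<^sup>1\<close>, provided that \<open>\<phi> t * t\<close> tends to \<open>0\<close>
  as \<open>t\<close> decreases to \<open>0\<close> and \<open>a\<close>, \<open>f\<close> are continuous.\<close>

definition weak_solution ::
    "(real \<Rightarrow> real) \<Rightarrow> ('a::euclidean_space \<Rightarrow> real) \<Rightarrow> (real \<Rightarrow> real) \<Rightarrow> ('a \<Rightarrow> real) \<Rightarrow> bool" where
  "weak_solution \<phi> a f u \<longleftrightarrow>
     (\<forall>\<psi>. test_function \<psi> \<longrightarrow>
        (LINT x|lborel. (\<phi> (norm (grad u x)) *\<^sub>R grad u x) \<bullet> grad \<psi> x)
        + (LINT x|lborel. a x * f (u x) * \<psi> x) = 0)"

definition solution ::
    "(real \<Rightarrow> real) \<Rightarrow> ('a::euclidean_space \<Rightarrow> real) \<Rightarrow> (real \<Rightarrow> real) \<Rightarrow> ('a \<Rightarrow> real) \<Rightarrow> bool" where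
  "solution \<phi> a f u \<longleftrightarrow>
     Ck 1 u \<and> (\<forall>x. u x > 0) \<and> filterlim u at_top at_infinity \<and> weak_solution \<phi> a f u"

text \<open>The sequence of radial functions \<open>u\<^sub>k(|x|)\<close> is given by its profiles \<open>u k\<close>, of which only
  the values on \<open>[0, \<infinity>)\<close> matter.\<close>

definition radial_solution_sequence ::
    "(real \<Rightarrow> real) \<Rightarrow> ('a::euclidean_space \<Rightarrow> real) \<Rightarrow> (real \<Rightarrow> real) \<Rightarrow> (nat \<Rightarrow> real \<Rightarrow> real) \<Rightarrow> bool" where
  "radial_solution_sequence \<phi> a f u \<longleftrightarrow>
     (\<forall>k. solution \<phi> a f (\<lambda>x. u k (norm x))) \<and> filterlim (\<lambda>k. u k 0) at_top sequentially"

end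

theory Submission
  imports Defs
begin

text \<open>Write \<open>h t = \<phi> t t\<close> and \<open>w = \<Phi>\<^sup>-\<^sup>1 \<circ> F\<close>. A positive radial function \<open>u(|x|)\<close> solves the equation iff
  \<open>h(u'(r)) = r\<^sup>1\<^sup>-\<^sup>N \<integral>\<^sub>0\<^sup>r t\<^sup>N\<^sup>-\<^sup>1 a(t) f(u(t)) dt\<close>: the radial field with these magnitudes has divergence \<open>a f(u)\<close>,
  and radial test functions show that no other radial field has the same weak divergence.

  If \<open>\<integral> dt / w(t) = \<infinity>\<close>, the integral equation with \<open>u(0) = \<alpha>\<close> is solved by monotone iteration, since on \<open>[0, R]\<close>
  the global solution of \<open>v' = C w(v)\<close>, \<open>v(0) = \<alpha>\<close>, is a supersolution when \<open>C\<close> is large; the hypothesis on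
  \<open>a\<close> makes \<open>u\<close> unbounded. If the integral converges, choose an interval where \<open>a \<ge> c > 0\<close>: an energy
  estimate gives \<open>u' \<ge> const * w(u)\<close> there, once \<open>u\<close> has doubled. A large \<open>u(0)\<close> makes both the doubling and
  the remaining life span shorter than the interval, so \<open>u(0)\<close> is bounded over all solutions.\<close>

section \<open>Calculus on half-lines\<close>

text \<open>Three comparisons supply the constants used for \<phi>. The lower bound
  \<open>l1\<close> says that \<open>t powr (- l1) * h t\<close> is non-decreasing, so a factor
  inside \<open>h_inv\<close> comes out as a power of itself. The bound \<open>l\<close> > 1 says
  that \<open>Phi \<phi> t / t\<close> is non-decreasing, so a factor at most 1 comes out of
  \<open>Phi_inv\<close>. The bound \<open>m\<close> controls \<open>h t * t\<close> by
  \<open>Phi \<phi> t\<close>. Since \<open>f\<close> is only continuous and monotone, nothing like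
  a Lipschitz condition is available for existence. Order replaces it: the iterates are defined on
  the whole half-line from the start, and only their upper bound depends on the interval, so no
  continuation of local solutions is needed. In the converse direction the obstacle is the weight
  r^(1-N), which keeps \<open>h (u' r)\<close> from being monotone and spoils a direct energy
  identity. On a short interval away from the origin the weight can be frozen at its value at the
  left end; this makes the flux monotone and costs only a constant factor in the slope.\<close>

lemma half_line_inverse:
  fixes H G :: "real \<Rightarrow> real"
  assumes cont: "continuous_on {a..} H" and mono: "strict_mono_on {a..} H"
    and lim: "filterlim H at_top at_top" and G: "\<And>t. a \<le> t \<Longrightarrow> G (H t) = t"
  shows "\<And>y. H a \<le> y \<Longrightarrow> a \<le> G y"
    and "\<And>y. H a \<le> y \<Longrightarrow> H (G y) = y"
    and "continuous_on {H a..} G"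
    and "\<And>x y. H a \<le> x \<Longrightarrow> x \<le> y \<Longrightarrow> G x \<le> G y"
    and "\<And>y D. H a < y \<Longrightarrow> DERIV H (G y) :> D \<Longrightarrow> D \<noteq> 0 \<Longrightarrow>
      DERIV G y :> inverse D"
proof -
  have big: "\<exists>T\<ge>a. y < H T" for y
  proof -
    have "eventually (\<lambda>T. y < H T \<and> a \<le> T) at_top"
      using lim by (auto simp: filterlim_at_top_dense intro!: eventually_conj eventually_ge_at_top)
    then show ?thesis using eventually_happens by force
  qed
  have surj: "\<exists>t\<ge>a. H t = y" if y: "H a \<le> y" for y
  proof -
    obtain T where T: "T \<ge> a" "y < H T" using big by blast
    have "continuous_on {a..T} H" using cont continuous_on_subset by fastforce
    then obtain x where "a \<le> x" "x \<le> T" "H x = y" using IVT'[of H a y T] y T by auto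
    then show ?thesis by auto
  qed
  show ge: "a \<le> G y" if "H a \<le> y" for y using surj[OF that] G by auto
  show right: "H (G y) = y" if "H a \<le> y" for y using surj[OF that] G by auto
  show mn: "G x \<le> G y" if "H a \<le> x" "x \<le> y" for x y
  proof (rule ccontr)
    assume "\<not> G x \<le> G y"
    then have "H (G y) < H (G x)"
      using mono ge[of x] ge[of y] that by (auto simp: strict_mono_on_def)
    then show False using right[of x] right[of y] that by auto
  qed
  have img: "H ` {a..T} = {H a..H T}" if "a \<le> T" for T
  proof
    show "H ` {a..T} \<subseteq> {H a..H T}"
      using strict_mono_on_leD[OF mono] by auto
    show "{H a..H T} \<subseteq> H ` {a..T}"
    proof
      fix y assume y: "y \<in> {H a..H T}"
      then have "G y \<le> G (H T)" using mn[of y "H T"] by auto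
      then have "G y \<in> {a..T}" using ge[of y] y G[of T] that by auto
      then show "y \<in> H ` {a..T}" using right[of y] y by force
    qed
  qed
  \<comment> \<open>On a compact interval the inverse of a continuous injection is continuous on the
    image, which \<open>img\<close> identifies. Every point of the half-line has such an image as a
    relative neighbourhood.\<close>
  have contT: "continuous_on {H a..H T} G" if "a \<le> T" for T
    using continuous_on_inv[of "{a..T}" H G] cont G img[OF that] continuous_on_subset[of "{a..}" H "{a..T}"]
    by auto
  show ct: "continuous_on {H a..} G"
    unfolding continuous_on_eq_continuous_within
  proof
    fix y assume y: "y \<in> {H a..}"
    obtain T where T: "T \<ge> a" "y < H T" using big by blast
    have "at y within {H a..} = at y within {H a..H T}"
      by (rule at_within_nhd[of y "{..<H T}"]) (use y T in auto)
    moreover have "continuous (at y within {H a..H T}) G"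
      using contT[OF T(1)] y T unfolding continuous_on_eq_continuous_within by auto
    ultimately show "continuous (at y within {H a..}) G"
      by simp
  qed
  show "DERIV G y :> inverse D" if "H a < y" "DERIV H (G y) :> D" "D \<noteq> 0" for y D
  proof (rule DERIV_inverse_function[where f=H and a="H a" and b="y+1"])
    have "at y within {H a..} = at y"
      using that(1) by (intro at_within_interior) (auto simp: interior_real_atLeast)
    then show "isCont G y" using ct that(1) unfolding continuous_on_eq_continuous_within
      by (metis atLeast_iff less_eq_real_def)
  qed (use that right in auto)
qed

text \<open>Links the two integrals in use: divergence is stated with the Lebesgue integral of a
  non-negative function, while the estimates work with Henstock-Kurzweil integrals over compact
  intervals.\<close>

lemma nn_integral_atLeast_infinite_iff:
  fixes g :: "real \<Rightarrow> real"
  assumes cont: "continuous_on {a..} g" and nn: "\<And>x. a \<le> x \<Longrightarrow> 0 \<le> g x"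
  shows "(\<integral>\<^sup>+x\<in>{a..}. ennreal (g x) \<partial>lborel) = \<infinity> \<longleftrightarrow> (\<forall>B. \<exists>x\<ge>a. B < integral {a..x} g)"
proof -
  \<comment> \<open>Continuing \<open>g\<close> by the constant \<open>g a\<close> to the left, and
    starting the primitive at \<open>a - 1\<close>, makes \<open>a\<close> an interior point, so the
    primitive has a two-sided derivative there.\<close>
  define g' where "g' x = g (max a x)" for x
  have c': "continuous_on UNIV g'" unfolding g'_def
    by (rule continuous_on_compose2[OF cont]) (auto intro!: continuous_intros)
  have nn': "0 \<le> g' x" for x using nn by (auto simp: g'_def)
  have ii: "g' integrable_on {x..y}" for x y
    by (intro integrable_continuous_interval continuous_on_subset[OF c']) auto
  define F where "F x = integral {a-1..x} g'" for x
  have FD: "DERIV F x :> g' x" if "a \<le> x" for x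
  proof -
    have "(F has_real_derivative g' x) (at x within {a-1..x+1})"
      unfolding F_def
      by (rule integral_has_real_derivative) (use that continuous_on_subset[OF c'] in auto)
    moreover have "at x within {a-1..x+1} = at x"
      using that by (intro at_within_interior) auto
    ultimately show ?thesis by simp
  qed
  have Fint: "F x - F a = integral {a..x} g" if "a \<le> x" for x
  proof -
    have "integral {a-1..a} g' + integral {a..x} g' = integral {a-1..x} g'"
      using that ii by (intro Henstock_Kurzweil_Integration.integral_combine) auto
    moreover have "integral {a..x} g' = integral {a..x} g"
      by (rule integral_cong) (auto simp: g'_def max_def)
    ultimately show ?thesis by (simp add: F_def)
  qed
  have Fmono: "F x \<le> F y" if "a \<le> x" "x \<le> y" for x y
    using that FD nn' by (intro DERIV_nonneg_imp_nondecreasing[of x y F]) (meson order_trans)+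
  have meas: "g' \<in> borel_measurable borel"
    using c' by (rule borel_measurable_continuous_onI)
  have eq: "(\<integral>\<^sup>+x\<in>{a..}. ennreal (g x) \<partial>lborel) = (\<integral>\<^sup>+x\<in>{a..}. ennreal (g' x) \<partial>lborel)"
    by (intro nn_integral_cong) (auto simp: g'_def max_def split: split_indicator)
  show ?thesis
  proof
    assume inf: "(\<integral>\<^sup>+x\<in>{a..}. ennreal (g x) \<partial>lborel) = \<infinity>"
    show "\<forall>B. \<exists>x\<ge>a. B < integral {a..x} g"
    proof (rule ccontr)
      assume "\<not> ?thesis"
      then obtain B where B: "\<And>x. a \<le> x \<Longrightarrow> integral {a..x} g \<le> B" by (meson not_le)
      define L where "L = (SUP x\<in>{a..}. F x)"
      have bdd: "bdd_above (F ` {a..})"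
        using B Fint by (intro bdd_aboveI2[where M="F a + B"]) (smt (verit) atLeast_iff)
      have "(F \<longlongrightarrow> L) at_top"
      proof (rule increasing_tendsto)
        show "\<forall>\<^sub>F n in at_top. F n \<le> L"
          using eventually_ge_at_top[of a]
          by eventually_elim (use bdd in \<open>auto simp: L_def intro!: cSUP_upper\<close>)
        fix x assume "x < L"
        then obtain y where y: "y \<ge> a" "x < F y"
          using less_cSUP_iff[of "{a..}" F x] bdd by (auto simp: L_def)
        show "\<forall>\<^sub>F n in at_top. x < F n"
          using eventually_ge_at_top[of y]
          by eventually_elim (use y Fmono in \<open>meson less_le_trans\<close>)
      qed
      then have "(\<integral>\<^sup>+x\<in>{a..}. ennreal (g' x) \<partial>lborel) = ennreal (L - F a)"
        using meas FD nn' by (intro nn_integral_FTC_atLeast) auto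
      then show False using inf eq by simp
    qed
  next
    assume unb: "\<forall>B. \<exists>x\<ge>a. B < integral {a..x} g"
    show "(\<integral>\<^sup>+x\<in>{a..}. ennreal (g x) \<partial>lborel) = \<infinity>"
    proof (rule ccontr)
      assume "\<not> ?thesis"
      then obtain B where B: "B \<ge> 0" "(\<integral>\<^sup>+x\<in>{a..}. ennreal (g x) \<partial>lborel) = ennreal B"
        by (metis ennreal_cases infinity_ennreal_def)
      obtain x where x: "x \<ge> a" "B < integral {a..x} g" using unb by blast
      have "ennreal (F x - F a) = (\<integral>\<^sup>+x\<in>{a..x}. ennreal (g' x) \<partial>lborel)"
        using meas FD nn' x by (intro nn_integral_FTC_Icc[symmetric]) (auto intro: has_field_derivative_at_within)
      also have "\<dots> \<le> (\<integral>\<^sup>+x\<in>{a..}. ennreal (g' x) \<partial>lborel)"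
        by (intro nn_integral_mono) (auto split: split_indicator)
      finally have "F x - F a \<le> B" using B eq by simp
      then show False using Fint x by auto
    qed
  qed
qed

text \<open>Derivatives relative to the half-line are the working notion: profiles and integrands
  have meaning only there, and the end point 0 is then covered together with the interior.\<close>

lemma integral_DERIV_atLeast:
  fixes g :: "real \<Rightarrow> real"
  assumes "continuous_on {a..} g" "a \<le> r"
  shows "((\<lambda>r. integral {a..r} g) has_real_derivative g r) (at r within {a..})"
proof -
  have "((\<lambda>r. integral {a..r} g) has_real_derivative g r) (at r within {a..r+1})"
    by (rule integral_has_real_derivative) (use assms continuous_on_subset[OF assms(1)] in auto)
  moreover have "at r within {a..} = at r within {a..r+1}"
    by (rule at_within_nhd[of r "{..<r+1}"]) (use assms in auto)
  ultimately show ?thesis by simp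
qed

lemma has_real_derivative_atLeast_interior:
  fixes a r :: real
  assumes "(g has_real_derivative D) (at r within {a..})" "a < r"
  shows "DERIV g r :> D"
proof -
  have "at r within {a..} = at r"
    using assms(2) by (intro at_within_interior) (auto simp: interior_real_atLeast)
  then show ?thesis using assms(1) by simp
qed

lemma continuous_on_atLeast_integrable:
  fixes g :: "real \<Rightarrow> real"
  assumes "continuous_on {a..} g" "a \<le> c"
  shows "g integrable_on {c..d}"
  using assms by (intro integrable_continuous_interval continuous_on_subset[OF assms(1)]) auto

lemma has_real_derivative_imp_continuous_on_atLeast:
  fixes g :: "real \<Rightarrow> real"
  assumes "\<And>r. a \<le> r \<Longrightarrow> (g has_real_derivative D r) (at r within {a..})"
  shows "continuous_on {a..} g"
  by (rule DERIV_continuous_on[OF assms]) auto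

text \<open>With \<open>n\<close> = N - 1 this is a flux: the radial field on R^N with radial
  component \<open>radial_mean n b r\<close> has divergence b(|x|). The value 0 at the origin is
  also the limit there when \<open>b\<close> is continuous.\<close>

definition radial_mean :: "nat \<Rightarrow> (real \<Rightarrow> real) \<Rightarrow> real \<Rightarrow> real" where
  "radial_mean n b s = integral {0..s} (\<lambda>t. t ^ n * b t) / s ^ n"

lemma radial_mean_0 [simp]: "radial_mean n b 0 = 0"
  by (simp add: radial_mean_def)

lemma power_mult_continuous:
  fixes b :: "real \<Rightarrow> real"
  shows "continuous_on {0..} b \<Longrightarrow> continuous_on {0..} (\<lambda>t. t ^ n * b t)"
  by (intro continuous_intros)

lemma radial_mean_mono:
  assumes "continuous_on {0..} b" "continuous_on {0..} c"
    and "\<And>t. 0 \<le> t \<Longrightarrow> t \<le> s \<Longrightarrow> b t \<le> c t" "0 \<le> s"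
  shows "radial_mean n b s \<le> radial_mean n c s"
  unfolding radial_mean_def using assms
  by (intro divide_right_mono integral_le continuous_on_atLeast_integrable[of 0])
     (auto intro: mult_left_mono power_mult_continuous)

lemma radial_mean_nonneg:
  assumes "continuous_on {0..} b" "\<And>t. 0 \<le> t \<Longrightarrow> 0 \<le> b t" "0 \<le> s"
  shows "0 \<le> radial_mean n b s"
  using radial_mean_mono[of "\<lambda>_. 0" b s n] assms by (simp add: radial_mean_def)

text \<open>The weight (t/s)^n is at most 1. The resulting bound is uniform down to s = 0, which
  yields continuity at the origin and later removes the weight when comparing with a
  supersolution.\<close>

lemma radial_mean_le_integral:
  assumes b: "continuous_on {0..} b" and c: "continuous_on {0..} c"
    and le: "\<And>t. 0 \<le> t \<Longrightarrow> t \<le> s \<Longrightarrow> b t \<le> c t" "\<And>t. 0 \<le> t \<Longrightarrow> t \<le> s \<Longrightarrow> 0 \<le> c t" and s: "0 \<le> s"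
  shows "radial_mean n b s \<le> integral {0..s} c"
proof (cases "s = 0")
  case False
  then have s0: "0 < s" using s by auto
  have "integral {0..s} (\<lambda>t. t ^ n * b t) \<le> integral {0..s} (\<lambda>t. s ^ n * c t)"
  proof (intro integral_le)
    fix t assume t: "t \<in> {0..s}"
    then have "t ^ n * b t \<le> t ^ n * c t" using le by (intro mult_left_mono) auto
    also have "\<dots> \<le> s ^ n * c t" using t le by (intro mult_right_mono power_mono) auto
    finally show "t ^ n * b t \<le> s ^ n * c t" .
  qed (use b c in \<open>auto intro!: continuous_on_atLeast_integrable[of 0] continuous_intros\<close>)
  then show ?thesis using s0 by (simp add: radial_mean_def field_simps)
qed (simp add: radial_mean_def)

lemma radial_mean_continuous:
  assumes b: "continuous_on {0..} b" and nn: "\<And>t. 0 \<le> t \<Longrightarrow> 0 \<le> b t"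
  shows "continuous_on {0..} (radial_mean n b)"
  unfolding continuous_on_eq_continuous_within
proof
  have ci: "continuous_on {0..} (\<lambda>s. integral {0..s} g)" if "continuous_on {0..} g" for g :: "real \<Rightarrow> real"
    using integral_DERIV_atLeast[OF that] by (rule has_real_derivative_imp_continuous_on_atLeast) auto
  fix s :: real assume s: "s \<in> {0..}"
  show "continuous (at s within {0..}) (radial_mean n b)"
  proof (cases "s = 0")
    case True
    have "((\<lambda>s. integral {0..s} b) \<longlongrightarrow> integral {0..0} b) (at 0 within {0..})"
      using ci[OF b] unfolding continuous_on_def by (rule bspec) simp
    then have lim: "((\<lambda>s. integral {0..s} b) \<longlongrightarrow> 0) (at 0 within {0..})" by simp
    have "(radial_mean n b \<longlongrightarrow> 0) (at 0 within {0..})"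
    proof (rule tendsto_sandwich[OF _ _ tendsto_const lim])
      show "\<forall>\<^sub>F s in at 0 within {0..}. 0 \<le> radial_mean n b s"
        using radial_mean_nonneg[OF b nn] by (auto simp: eventually_at intro!: exI[of _ 1])
      show "\<forall>\<^sub>F s in at 0 within {0..}. radial_mean n b s \<le> integral {0..s} b"
        using radial_mean_le_integral[OF b b] nn by (auto simp: eventually_at intro!: exI[of _ 1])
    qed
    then show ?thesis using True by (simp add: continuous_within)
  next
    case False
    have "((\<lambda>s. integral {0..s} (\<lambda>t. t ^ n * b t)) \<longlongrightarrow> integral {0..s} (\<lambda>t. t ^ n * b t)) (at s within {0..})"
      using ci[OF power_mult_continuous[OF b]] s by (simp add: continuous_on_def)
    then show ?thesis using False unfolding radial_mean_def continuous_within
      by (intro tendsto_intros) auto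
  qed
qed

section \<open>The functions \<open>h\<close> and \<open>\<Phi>\<close>\<close>

locale phi_laplacian =
  fixes \<phi> :: "real \<Rightarrow> real" and l m l1 :: real
  assumes phi_C1: "\<phi> C1_differentiable_on {0<..}"
    and phi_pos: "\<And>t. 0 < t \<Longrightarrow> 0 < \<phi> t"
    and phi_deriv: "\<And>t. 0 < t \<Longrightarrow> 0 < deriv (\<lambda>s. \<phi> s * s) t"
    and l_gt: "1 < l" and m_gt: "1 < m"
    and l_le: "\<And>t. 0 < t \<Longrightarrow> l \<le> \<phi> t * t\<^sup>2 / Phi \<phi> t"
    and le_m: "\<And>t. 0 < t \<Longrightarrow> \<phi> t * t\<^sup>2 / Phi \<phi> t \<le> m"
    and l1_pos: "0 < l1"
    and l1_le: "\<And>t. 0 < t \<Longrightarrow> l1 \<le> deriv (deriv (Phi \<phi>)) t * t / deriv (Phi \<phi>) t"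
begin

definition h :: "real \<Rightarrow> real" where "h t = \<phi> t * t"

lemma h_0 [simp]: "h 0 = 0" by (simp add: h_def)

lemma h_pos: "0 < t \<Longrightarrow> 0 < h t" by (simp add: h_def phi_pos)

lemma h_nonneg: "0 \<le> t \<Longrightarrow> 0 \<le> h t" using h_pos[of t] by (cases "t = 0") auto

lemma h_DERIV: "0 < t \<Longrightarrow> DERIV h t :> deriv h t"
proof -
  assume t: "0 < t"
  obtain D where "(\<phi> has_vector_derivative D) (at t)"
    using phi_C1 t unfolding C1_differentiable_on_def by auto
  then have "DERIV \<phi> t :> D" by (simp add: has_real_derivative_iff_has_vector_derivative)
  then have "DERIV h t :> D * t + \<phi> t * 1" unfolding h_def[abs_def]
    by (auto intro!: derivative_eq_intros)
  then show ?thesis using DERIV_imp_deriv by fastforce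
qed

lemma h_deriv_pos: "0 < t \<Longrightarrow> 0 < deriv h t"
  using phi_deriv by (simp add: h_def[abs_def])

lemma isCont_h: "0 < t \<Longrightarrow> isCont h t"
  using h_DERIV DERIV_isCont by blast

lemma Phi_eq: "0 \<le> t \<Longrightarrow> Phi \<phi> t = integral {0..t} h"
  by (simp add: Phi_def h_def[abs_def])

lemma Phi_0 [simp]: "Phi \<phi> 0 = 0" by (simp add: Phi_def)

text \<open>Division by 0 gives 0, so a quotient that is at least \<open>l\<close> > 1 rules out a
  vanishing as well as a negative denominator.\<close>

lemma Phi_pos: "0 < t \<Longrightarrow> 0 < Phi \<phi> t"
proof -
  assume t: "0 < t"
  have "0 < \<phi> t * t\<^sup>2 / Phi \<phi> t" using l_le[OF t] l_gt by linarith
  moreover have "0 < \<phi> t * t\<^sup>2" using t phi_pos by simp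
  ultimately show ?thesis by (simp add: zero_less_divide_iff)
qed

lemma l_Phi_le: "0 < t \<Longrightarrow> l * Phi \<phi> t \<le> h t * t"
  using l_le[of t] Phi_pos[of t] by (simp add: h_def field_simps power2_eq_square)

lemma le_m_Phi: "0 < t \<Longrightarrow> h t * t \<le> m * Phi \<phi> t"
  using le_m[of t] Phi_pos[of t] by (simp add: h_def field_simps power2_eq_square)

text \<open>Nothing is assumed directly about \<phi> near 0. A non-integrable function has integral
  0 by convention, so positivity of \<open>Phi \<phi> t\<close> already forces
  integrability.\<close>

lemma h_integrable: "h integrable_on {0..t}"
proof (cases "t > 0")
  case True
  then show ?thesis using Phi_pos[of t] Phi_eq[of t] not_integrable_integral by fastforce
next
  case False
  then have "{0..t} = {} \<or> {0..t} = {0}" by auto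
  then show ?thesis by (auto simp: integrable_on_refl[of h 0, simplified])
qed

lemma Phi_DERIV: "0 < t \<Longrightarrow> DERIV (Phi \<phi>) t :> h t"
proof -
  assume t: "0 < t"
  \<comment> \<open>Only continuity of \<open>h\<close> at the point \<open>t\<close> enters. The
    behaviour of \<open>h\<close> at 0 is still unknown and will follow from \<open>h_scale\<close>,
    which itself depends on this derivative.\<close>
  have "((\<lambda>u. integral {0..u} h) has_vector_derivative h t) (at t within {0..t+1} - {})"
    by (rule integral_has_vector_derivative_continuous_at)
       (use t h_integrable isCont_h[OF t] in \<open>auto intro: continuous_at_imp_continuous_at_within\<close>)
  moreover have "at t within {0..t+1} = at t"
    using t by (intro at_within_interior) auto
  ultimately have "DERIV (\<lambda>u. integral {0..u} h) t :> h t"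
    by (metis Diff_empty has_real_derivative_iff_has_vector_derivative)
  then show ?thesis
    by (rule has_field_derivative_transform_within_open[of _ _ _ "{0<..}"]) (use t in \<open>auto simp: Phi_eq\<close>)
qed

lemma l1_h_le: "0 < t \<Longrightarrow> l1 * h t \<le> deriv h t * t"
proof -
  assume t: "0 < t"
  have 1: "deriv (Phi \<phi>) s = h s" if "0 < s" for s
    using Phi_DERIV[OF that] DERIV_imp_deriv by blast
  have "eventually (\<lambda>s. deriv (Phi \<phi>) s = h s) (nhds t)"
    using eventually_nhds_in_open[of "{0<..}" t] t 1 by (auto elim!: eventually_mono)
  then have "deriv (deriv (Phi \<phi>)) t = deriv h t" by (rule deriv_cong_ev) simp
  then show ?thesis using l1_le[OF t] h_pos[OF t] 1[OF t] by (simp add: field_simps)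
qed

text \<open>The integrated form of the bound \<open>l1\<close>: the derivative of
  \<open>h x * x powr (- l1)\<close> is \<open>deriv h x * x - l1 * h x\<close> times a positive
  power of x.\<close>

lemma h_powr_mono:
  assumes "0 < s" "s \<le> t"
  shows "h s * s powr (- l1) \<le> h t * t powr (- l1)"
proof (rule DERIV_nonneg_imp_nondecreasing[OF assms(2)])
  fix x assume "s \<le> x" "x \<le> t"
  then have x: "0 < x" using assms by auto
  have "DERIV (\<lambda>x. h x * x powr (- l1)) x :> deriv h x * x powr (- l1) + h x * (- l1 * x powr (- l1 - 1))"
    using x by (auto intro!: derivative_eq_intros h_DERIV)
  moreover have "deriv h x * x powr (- l1) + h x * (- l1 * x powr (- l1 - 1))
      = (deriv h x * x - l1 * h x) * x powr (- l1 - 1)"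
    using x powr_mult_base[of x "- l1 - 1"] by (simp add: algebra_simps)
  moreover have "0 \<le> (deriv h x * x - l1 * h x) * x powr (- l1 - 1)"
    using l1_h_le[OF x] by simp
  ultimately show "\<exists>y. DERIV (\<lambda>x. h x * x powr - l1) x :> y \<and> 0 \<le> y"
    by metis
qed

text \<open>All growth information about \<open>h\<close> is taken from here: t = 1 gives the limit
  0 at the origin, c = 1/t gives the limit at infinity, and inversion lets constants pass through
  \<open>h_inv\<close>.\<close>

lemma h_scale: "0 < c \<Longrightarrow> c \<le> 1 \<Longrightarrow> 0 < t \<Longrightarrow> h (c * t) \<le> c powr l1 * h t"
proof -
  assume a: "0 < c" "c \<le> 1" "0 < t"
  then have "c * t \<le> t" using mult_right_mono[of c 1 t] by simp
  then have "h (c * t) * (c * t) powr (- l1) \<le> h t * t powr (- l1)"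
    using a by (intro h_powr_mono) auto
  then show ?thesis using a by (simp add: powr_mult powr_minus field_simps)
qed

lemma h_strict_mono: "strict_mono_on {0..} h"
proof (rule strict_mono_onI)
  fix r s :: real assume "r \<in> {0..}" "s \<in> {0..}" "r < s"
  show "h r < h s"
  proof (cases "r = 0")
    case True
    then show ?thesis using h_pos \<open>r < s\<close> by auto
  next
    case False
    then have "0 < r" using \<open>r \<in> _\<close> by auto
    then show ?thesis
      by (intro DERIV_pos_imp_increasing[OF \<open>r < s\<close>]) (meson h_DERIV h_deriv_pos less_le_trans)
  qed
qed

lemma h_tendsto_0: "(h \<longlongrightarrow> 0) (at_right 0)"
proof (rule tendsto_sandwich)
  show "\<forall>\<^sub>F t in at_right 0. 0 \<le> h t"
    by (auto simp: eventually_at_right_less h_nonneg eventually_at intro!: exI[of _ 1])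
  show "\<forall>\<^sub>F t in at_right 0. h t \<le> t powr l1 * h 1"
    using h_scale[of _ 1] by (auto simp: eventually_at intro!: exI[of _ 1])
  show "((\<lambda>t. t powr l1 * h 1) \<longlongrightarrow> 0) (at_right 0)"
    using l1_pos by (auto intro!: tendsto_eq_intros tendsto_powr' simp: eventually_at intro!: exI[of _ 1])
qed simp

lemma h_continuous: "continuous_on {0..} h"
  unfolding continuous_on_eq_continuous_within
proof
  fix t :: real assume t: "t \<in> {0..}"
  show "continuous (at t within {0..}) h"
  proof (cases "t = 0")
    case True
    then show ?thesis using h_tendsto_0 by (simp add: continuous_within at_within_Ici_at_right)
  next
    case False
    then show ?thesis using t isCont_h[of t] continuous_at_imp_continuous_at_within by auto
  qed
qed

lemma h_at_top: "filterlim h at_top at_top"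
proof (rule filterlim_at_top_mono)
  show "filterlim (\<lambda>t. t powr l1 * h 1) at_top at_top"
    using l1_pos h_pos[of 1]
    by (intro filterlim_at_top_mult_tendsto_pos[OF tendsto_const]) (auto intro: real_powr_at_top)
  show "\<forall>\<^sub>F t in at_top. t powr l1 * h 1 \<le> h t"
    using eventually_ge_at_top[of 1]
  proof eventually_elim
    case (elim t)
    then have "h (1/t * t) \<le> (1/t) powr l1 * h t" by (intro h_scale) auto
    then show ?case using elim by (simp add: powr_divide field_simps)
  qed
qed

text \<open>The value patched in at 0 fits because \<open>h 0 = 0\<close> whatever
  \<open>\<phi> 0\<close> is; elsewhere strict monotonicity gives injectivity.\<close>

lemma h_inv_h: "0 \<le> t \<Longrightarrow> h_inv \<phi> (h t) = t"
proof (cases "t = 0")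
  case False
  assume "0 \<le> t"
  then have t: "t > 0" using False by auto
  have "inj_on h {0<..}"
    using strict_mono_on_imp_inj_on[OF h_strict_mono] by (rule inj_on_subset) auto
  then show ?thesis using t h_pos[OF t] inv_into_f_f[of h "{0<..}" t]
      phi_pos[OF t] by (simp add: h_inv_def h_def[abs_def])
qed (simp add: h_inv_def)

lemmas h_inv_facts = half_line_inverse[OF h_continuous h_strict_mono h_at_top h_inv_h, unfolded h_0]

lemma h_inv_0 [simp]: "h_inv \<phi> 0 = 0" by (simp add: h_inv_def)

lemma h_inv_nonneg: "0 \<le> y \<Longrightarrow> 0 \<le> h_inv \<phi> y"
  and h_h_inv: "0 \<le> y \<Longrightarrow> h (h_inv \<phi> y) = y"
  and h_inv_continuous: "continuous_on {0..} (h_inv \<phi>)"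
  and h_inv_mono: "0 \<le> x \<Longrightarrow> x \<le> y \<Longrightarrow> h_inv \<phi> x \<le> h_inv \<phi> y"
  using h_inv_facts by blast+

lemma h_inv_pos: "0 < y \<Longrightarrow> 0 < h_inv \<phi> y"
  using h_inv_nonneg[of y] h_h_inv[of y] by (cases "h_inv \<phi> y = 0") auto

lemma h_inv_le: "0 \<le> t \<Longrightarrow> 0 \<le> y \<Longrightarrow> y \<le> h t \<Longrightarrow> h_inv \<phi> y \<le> t"
  using h_inv_mono[of y "h t"] h_inv_h by simp

lemma le_h_inv: "0 \<le> t \<Longrightarrow> h t \<le> y \<Longrightarrow> t \<le> h_inv \<phi> y"
  using h_inv_mono[of "h t" y] h_inv_h h_nonneg by simp

lemma h_inv_DERIV: "0 < y \<Longrightarrow> DERIV (h_inv \<phi>) y :> inverse (deriv h (h_inv \<phi> y))"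
proof -
  assume y: "0 < y"
  note p = h_inv_pos[OF y]
  show ?thesis using h_inv_facts(5)[OF _ y h_DERIV[OF p]] h_deriv_pos[OF p] by auto
qed

text \<open>This is \<open>h_scale\<close> with the factor \<open>c powr (1 / l1)\<close>, whose
  \<open>l1\<close>-th power is \<open>c\<close>, read through the inverse.\<close>

lemma h_inv_scale: "0 < c \<Longrightarrow> c \<le> 1 \<Longrightarrow> 0 \<le> y \<Longrightarrow> c powr (1 / l1) * h_inv \<phi> y \<le> h_inv \<phi> (c * y)"
proof (cases "y = 0")
  case False
  assume a: "0 < c" "c \<le> 1" "0 \<le> y"
  then have p: "0 < h_inv \<phi> y" using False h_inv_pos by simp
  have "h (c powr (1 / l1) * h_inv \<phi> y) \<le> (c powr (1 / l1)) powr l1 * h (h_inv \<phi> y)"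
    using a p l1_pos by (intro h_scale) (auto intro: powr_le1)
  also have "\<dots> = c * y" using a l1_pos h_h_inv by (simp add: powr_powr)
  finally show ?thesis using p by (intro le_h_inv) auto
qed simp

section \<open>The primitive of h and its inverse\<close>

lemma Phi_strict_mono: "strict_mono_on {0..} (Phi \<phi>)"
proof (rule strict_mono_onI)
  fix r s :: real assume "r \<in> {0..}" "s \<in> {0..}" "r < s"
  show "Phi \<phi> r < Phi \<phi> s"
  proof (cases "r = 0")
    case True
    then show ?thesis using Phi_pos \<open>r < s\<close> by auto
  next
    case False
    then have "0 < r" using \<open>r \<in> _\<close> by auto
    then show ?thesis
      by (intro DERIV_pos_imp_increasing[OF \<open>r < s\<close>]) (meson Phi_DERIV h_pos less_le_trans)
  qed
qed

lemma Phi_nonneg: "0 \<le> t \<Longrightarrow> 0 \<le> Phi \<phi> t"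
  using Phi_pos[of t] by (cases "t = 0") auto

lemma Phi_mono: "0 \<le> s \<Longrightarrow> s \<le> t \<Longrightarrow> Phi \<phi> s \<le> Phi \<phi> t"
  using strict_mono_on_leD[OF Phi_strict_mono] by auto

lemma Phi_continuous: "continuous_on {0..} (Phi \<phi>)"
proof -
  have 1: "continuous_on {0..T} (Phi \<phi>)" for T
    using indefinite_integral_continuous_1[OF h_integrable[of T]]
    by (rule continuous_on_eq) (auto simp: Phi_eq)
  show ?thesis unfolding continuous_on_eq_continuous_within
  proof
    fix t :: real assume t: "t \<in> {0..}"
    have "at t within {0..} = at t within {0..t+1}"
      by (rule at_within_nhd[of t "{..<t+1}"]) (use t in auto)
    then show "continuous (at t within {0..}) (Phi \<phi>)"
      using 1[of "t+1"] t unfolding continuous_on_eq_continuous_within by auto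
  qed
qed

text \<open>\<open>Phi \<phi> x / x\<close> is non-decreasing, because its derivative has the sign
  of \<open>h x * x - Phi \<phi> x\<close>, and \<open>l\<close> > 1 makes this
  non-negative.\<close>

lemma Phi_scale: "0 < c \<Longrightarrow> c \<le> 1 \<Longrightarrow> 0 < t \<Longrightarrow> Phi \<phi> (c * t) \<le> c * Phi \<phi> t"
proof -
  assume a: "0 < c" "c \<le> 1" "0 < t"
  then have le: "c * t \<le> t" using mult_right_mono[of c 1 t] by simp
  have "Phi \<phi> (c * t) / (c * t) \<le> Phi \<phi> t / t"
  proof (rule DERIV_nonneg_imp_nondecreasing[OF le])
    fix x assume "c * t \<le> x" "x \<le> t"
    then have x: "0 < x" using a by (meson mult_pos_pos less_le_trans)
    have "DERIV (\<lambda>x. Phi \<phi> x / x) x :> (h x * x - Phi \<phi> x * 1) / (x * x)"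
      using x by (auto intro!: derivative_eq_intros Phi_DERIV)
    moreover have "Phi \<phi> x \<le> l * Phi \<phi> x"
      using l_gt Phi_pos[OF x] by simp
    then have "0 \<le> (h x * x - Phi \<phi> x * 1) / (x * x)"
      using l_Phi_le[OF x] by simp
    ultimately show "\<exists>y. DERIV (\<lambda>x. Phi \<phi> x / x) x :> y \<and> 0 \<le> y" by blast
  qed
  then show ?thesis using a by (simp add: field_simps)
qed

lemma Phi_at_top: "filterlim (Phi \<phi>) at_top at_top"
proof (rule filterlim_at_top_mono)
  show "filterlim (\<lambda>t. t * Phi \<phi> 1) at_top at_top"
    using Phi_pos[of 1]
    by (intro filterlim_at_top_mult_tendsto_pos[OF tendsto_const]) (auto intro: filterlim_ident)
  show "\<forall>\<^sub>F t in at_top. t * Phi \<phi> 1 \<le> Phi \<phi> t"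
    using eventually_ge_at_top[of 1]
  proof eventually_elim
    case (elim t)
    then have "Phi \<phi> (1/t * t) \<le> (1/t) * Phi \<phi> t" by (intro Phi_scale) auto
    then show ?case using elim by (simp add: field_simps)
  qed
qed

lemma Phi_inv_Phi: "0 \<le> t \<Longrightarrow> Phi_inv \<phi> (Phi \<phi> t) = t"
  using strict_mono_on_imp_inj_on[OF Phi_strict_mono] by (simp add: Phi_inv_def)

lemmas Phi_inv_facts =
  half_line_inverse[OF Phi_continuous Phi_strict_mono Phi_at_top Phi_inv_Phi, unfolded Phi_0]

lemma Phi_inv_nonneg: "0 \<le> y \<Longrightarrow> 0 \<le> Phi_inv \<phi> y"
  and Phi_Phi_inv: "0 \<le> y \<Longrightarrow> Phi \<phi> (Phi_inv \<phi> y) = y"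
  and Phi_inv_continuous: "continuous_on {0..} (Phi_inv \<phi>)"
  and Phi_inv_mono: "0 \<le> x \<Longrightarrow> x \<le> y \<Longrightarrow> Phi_inv \<phi> x \<le> Phi_inv \<phi> y"
  using Phi_inv_facts by blast+

lemma Phi_inv_pos: "0 < y \<Longrightarrow> 0 < Phi_inv \<phi> y"
  using Phi_inv_nonneg[of y] Phi_Phi_inv[of y] by (cases "Phi_inv \<phi> y = 0") auto

lemma Phi_inv_le: "0 \<le> t \<Longrightarrow> 0 \<le> y \<Longrightarrow> y \<le> Phi \<phi> t \<Longrightarrow> Phi_inv \<phi> y \<le> t"
  using Phi_inv_mono[of y "Phi \<phi> t"] Phi_inv_Phi by simp

lemma le_Phi_inv: "0 \<le> t \<Longrightarrow> Phi \<phi> t \<le> y \<Longrightarrow> t \<le> Phi_inv \<phi> y"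
  using Phi_inv_mono[of "Phi \<phi> t" y] Phi_inv_Phi Phi_nonneg by simp

lemma Phi_inv_DERIV: "0 < y \<Longrightarrow> DERIV (Phi_inv \<phi>) y :> inverse (h (Phi_inv \<phi> y))"
proof -
  assume y: "0 < y"
  note p = Phi_inv_pos[OF y]
  show ?thesis using Phi_inv_facts(5)[OF _ y Phi_DERIV[OF p]] h_pos[OF p] by auto
qed

lemma Phi_inv_scale: "0 < c \<Longrightarrow> c \<le> 1 \<Longrightarrow> 0 \<le> y \<Longrightarrow> c * Phi_inv \<phi> y \<le> Phi_inv \<phi> (c * y)"
proof (cases "y = 0")
  case False
  assume a: "0 < c" "c \<le> 1" "0 \<le> y"
  then have p: "0 < Phi_inv \<phi> y" using False Phi_inv_pos by simp
  have "Phi \<phi> (c * Phi_inv \<phi> y) \<le> c * Phi \<phi> (Phi_inv \<phi> y)"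
    using a p by (intro Phi_scale)
  also have "\<dots> = c * y" using a Phi_Phi_inv by simp
  finally show ?thesis using p a by (intro le_Phi_inv) auto
qed (use Phi_inv_Phi[of 0] in simp)

end

section \<open>The radial integral equation\<close>

locale radial_problem = phi_laplacian +
  fixes a0 f :: "real \<Rightarrow> real" and n :: nat
  assumes a0_continuous: "continuous_on {0..} a0"
    and a0_nonneg: "\<And>t. 0 \<le> t \<Longrightarrow> 0 \<le> a0 t"
    and f_continuous: "continuous_on {0..} f"
    and f_mono_on: "mono_on {0..} f"
    and f_zero: "f 0 = 0"
    and f_pos: "\<And>s. 0 < s \<Longrightarrow> 0 < f s"
begin

lemma f_mono: "0 \<le> s \<Longrightarrow> s \<le> t \<Longrightarrow> f s \<le> f t"
  using f_mono_on by (auto simp: mono_on_def)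

lemma f_nonneg: "0 \<le> s \<Longrightarrow> 0 \<le> f s"
  using f_pos[of s] f_zero by (cases "s = 0") auto

definition F :: "real \<Rightarrow> real" where "F t = integral {0..t} f"

definition w :: "real \<Rightarrow> real" where "w t = Phi_inv \<phi> (F t)"

lemma F_DERIV: "0 < t \<Longrightarrow> DERIV F t :> f t"
  unfolding F_def
  by (rule has_real_derivative_atLeast_interior[OF integral_DERIV_atLeast[OF f_continuous]]) auto

lemma F_0 [simp]: "F 0 = 0" by (simp add: F_def)

lemma F_continuous: "continuous_on {0..} F"
  unfolding F_def
  by (rule has_real_derivative_imp_continuous_on_atLeast[OF integral_DERIV_atLeast[OF f_continuous]])

lemma F_less:
  assumes "0 \<le> s" "s < t"
  shows "F s < F t"
proof (rule DERIV_pos_imp_increasing_open[OF assms(2)])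
  show "continuous_on {s..t} F" using continuous_on_subset[OF F_continuous] assms by auto
  fix x assume "s < x" "x < t"
  then show "\<exists>y. DERIV F x :> y \<and> 0 < y" using F_DERIV f_pos assms by (meson le_less_trans)
qed

lemma F_mono: "0 \<le> s \<Longrightarrow> s \<le> t \<Longrightarrow> F s \<le> F t"
  using F_less[of s t] by (cases "s = t") auto

lemma F_pos: "0 < t \<Longrightarrow> 0 < F t" using F_less[of 0 t] by simp

lemma F_nonneg: "0 \<le> t \<Longrightarrow> 0 \<le> F t" using F_mono[of 0 t] by simp

lemma w_pos: "0 < t \<Longrightarrow> 0 < w t" by (simp add: w_def F_pos Phi_inv_pos)

lemma w_mono: "0 \<le> s \<Longrightarrow> s \<le> t \<Longrightarrow> w s \<le> w t"
  by (simp add: w_def F_mono F_nonneg Phi_inv_mono)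

lemma w_continuous: "continuous_on {0..} w"
  unfolding w_def
  by (rule continuous_on_compose2[OF Phi_inv_continuous F_continuous]) (auto simp: F_nonneg)

text \<open>Formally, differentiate \<open>Phi \<phi> (w t) = F t\<close>.\<close>

lemma w_DERIV: "0 < t \<Longrightarrow> DERIV w t :> f t / h (w t)"
proof -
  assume t: "0 < t"
  have "DERIV (\<lambda>t. Phi_inv \<phi> (F t)) t :> inverse (h (Phi_inv \<phi> (F t))) * f t"
    using DERIV_chain2[OF Phi_inv_DERIV[OF F_pos[OF t]] F_DERIV[OF t]] .
  then show ?thesis unfolding w_def[abs_def] by (simp add: divide_inverse mult.commute)
qed

lemma inverse_w_continuous: "0 < c \<Longrightarrow> continuous_on {c..} (\<lambda>t. 1 / w t)"
proof (intro continuous_intros continuous_on_subset[OF w_continuous] ballI)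
  fix t assume "0 < c" "t \<in> {c..}"
  then have "0 < t" by simp
  then show "w t \<noteq> 0" using w_pos by (metis less_irrefl)
qed auto

text \<open>The value that \<open>h (y' s)\<close> has to take if the profile \<open>y\<close> is to
  solve the equation.\<close>

definition source :: "(real \<Rightarrow> real) \<Rightarrow> real \<Rightarrow> real" where
  "source y s = radial_mean n (\<lambda>t. a0 t * f (y t)) s"

text \<open>Its fixed points are the profiles with initial value \<alpha>. The operator preserves
  order since \<open>f\<close> and \<open>h_inv\<close> are monotone; the iteration relies on this
  instead of a contraction.\<close>

definition picard :: "real \<Rightarrow> (real \<Rightarrow> real) \<Rightarrow> real \<Rightarrow> real" where
  "picard \<alpha> y r = \<alpha> + integral {0..r} (\<lambda>s. h_inv \<phi> (source y s))"

lemma a0_f_continuous: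
  assumes "continuous_on {0..} y" "\<And>t. 0 \<le> t \<Longrightarrow> 0 \<le> y t"
  shows "continuous_on {0..} (\<lambda>t. a0 t * f (y t))"
  using assms by (intro continuous_intros a0_continuous continuous_on_compose2[OF f_continuous]) auto

lemma source_nonneg:
  assumes "continuous_on {0..} y" "\<And>t. 0 \<le> t \<Longrightarrow> 0 \<le> y t" "0 \<le> s"
  shows "0 \<le> source y s"
  unfolding source_def using assms
  by (intro radial_mean_nonneg a0_f_continuous) (auto simp: a0_nonneg f_nonneg)

lemma source_mono:
  assumes "continuous_on {0..} y" "\<And>t. 0 \<le> t \<Longrightarrow> 0 \<le> y t"
    and "continuous_on {0..} z" "\<And>t. 0 \<le> t \<Longrightarrow> 0 \<le> z t"
    and "\<And>t. 0 \<le> t \<Longrightarrow> t \<le> s \<Longrightarrow> y t \<le> z t" "0 \<le> s"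
  shows "source y s \<le> source z s"
  unfolding source_def
proof (intro radial_mean_mono a0_f_continuous)
  fix t assume "0 \<le> t" "t \<le> s"
  then show "a0 t * f (y t) \<le> a0 t * f (z t)"
    using assms by (intro mult_left_mono f_mono a0_nonneg) auto
qed (use assms in auto)

lemma slope_continuous:
  assumes "continuous_on {0..} y" "\<And>t. 0 \<le> t \<Longrightarrow> 0 \<le> y t"
  shows "continuous_on {0..} (\<lambda>s. h_inv \<phi> (source y s))"
proof (rule continuous_on_compose2[OF h_inv_continuous])
  show "continuous_on {0..} (source y)"
    unfolding source_def using assms
    by (intro radial_mean_continuous a0_f_continuous) (auto simp: a0_nonneg f_nonneg)
qed (use assms source_nonneg in auto)

lemma picard_DERIV:
  assumes "continuous_on {0..} y" "\<And>t. 0 \<le> t \<Longrightarrow> 0 \<le> y t" "0 \<le> r"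
  shows "(picard \<alpha> y has_real_derivative h_inv \<phi> (source y r)) (at r within {0..})"
  unfolding picard_def using DERIV_add[OF DERIV_const integral_DERIV_atLeast[OF slope_continuous[OF assms(1,2)] assms(3)], of \<alpha>]
  by simp

lemma picard_continuous:
  assumes "continuous_on {0..} y" "\<And>t. 0 \<le> t \<Longrightarrow> 0 \<le> y t"
  shows "continuous_on {0..} (picard \<alpha> y)"
  using picard_DERIV[OF assms] by (rule has_real_derivative_imp_continuous_on_atLeast)

lemma picard_ge:
  assumes "continuous_on {0..} y" "\<And>t. 0 \<le> t \<Longrightarrow> 0 \<le> y t" "0 \<le> r"
  shows "\<alpha> \<le> picard \<alpha> y r"
proof -
  have "0 \<le> integral {0..r} (\<lambda>s. h_inv \<phi> (source y s))"
    using continuous_on_atLeast_integrable[OF slope_continuous[OF assms(1,2)], of 0 r] assms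
    by (intro Henstock_Kurzweil_Integration.integral_nonneg) (auto intro!: h_inv_nonneg source_nonneg)
  then show ?thesis by (simp add: picard_def)
qed

lemma picard_mono:
  assumes y: "continuous_on {0..} y" "\<And>t. 0 \<le> t \<Longrightarrow> 0 \<le> y t"
    and z: "continuous_on {0..} z" "\<And>t. 0 \<le> t \<Longrightarrow> 0 \<le> z t"
    and le: "\<And>t. 0 \<le> t \<Longrightarrow> t \<le> r \<Longrightarrow> y t \<le> z t" "0 \<le> r"
  shows "picard \<alpha> y r \<le> picard \<alpha> z r"
proof -
  have "integral {0..r} (\<lambda>s. h_inv \<phi> (source y s)) \<le> integral {0..r} (\<lambda>s. h_inv \<phi> (source z s))"
  proof (rule integral_le)
    fix s assume s: "s \<in> {0..r}"
    then show "h_inv \<phi> (source y s) \<le> h_inv \<phi> (source z s)"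
      using source_mono[OF y z, of s] source_nonneg[OF y, of s] le by (intro h_inv_mono) auto
  qed (use slope_continuous[OF y] slope_continuous[OF z] in \<open>auto intro: continuous_on_atLeast_integrable\<close>)
  then show ?thesis by (simp add: picard_def)
qed

text \<open>Moving the lower limit from 1 to \<alpha> changes the integral by a finite amount. The
  auxiliary point \<open>min 1 \<alpha>\<close> lies below both limits, and \<open>1 / w\<close> is
  still continuous there because it is positive.\<close>

lemma integral_inverse_w_at_top:
  assumes KO: "\<And>B. \<exists>x\<ge>1. B < integral {1..x} (\<lambda>t. 1 / w t)" and \<alpha>: "0 < \<alpha>"
  shows "filterlim (\<lambda>x. integral {\<alpha>..x} (\<lambda>t. 1 / w t)) at_top at_top"
  unfolding filterlim_at_top
proof
  fix Z
  define c where "c = min 1 \<alpha>"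
  have c: "0 < c" "c \<le> 1" "c \<le> \<alpha>" using \<alpha> by (auto simp: c_def)
  note int = continuous_on_atLeast_integrable[OF inverse_w_continuous[OF c(1)]]
  obtain x where x: "1 \<le> x" "Z + integral {c..\<alpha>} (\<lambda>t. 1 / w t) < integral {1..x} (\<lambda>t. 1 / w t)"
    using KO by blast
  have "Z \<le> integral {\<alpha>..y} (\<lambda>t. 1 / w t)" if y: "max x \<alpha> \<le> y" for y
  proof -
    have "integral {1..x} (\<lambda>t. 1 / w t) \<le> integral {c..y} (\<lambda>t. 1 / w t)"
      using c x y int[of 1] int[of c] w_pos
      by (intro integral_subset_le) (auto simp: less_imp_le)
    also have "\<dots> = integral {c..\<alpha>} (\<lambda>t. 1 / w t) + integral {\<alpha>..y} (\<lambda>t. 1 / w t)"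
      using c y int[of c] by (intro Henstock_Kurzweil_Integration.integral_combine[symmetric]) auto
    finally show ?thesis using x by linarith
  qed
  then show "\<forall>\<^sub>F x in at_top. Z \<le> integral {\<alpha>..x} (\<lambda>t. 1 / w t)"
    unfolding eventually_at_top_linorder by blast
qed

text \<open>The supersolution solves \<open>v' = C w(v)\<close>: the quantity \<open>h (w (v r))\<close> then grows at least as
  fast as \<open>l1 C f (v r)\<close>, which dominates \<open>a0 r f (v r)\<close> for large \<open>C\<close>.\<close>

lemma supersolution_exists:
  assumes KO: "\<And>B. \<exists>x\<ge>1. B < integral {1..x} (\<lambda>t. 1 / w t)" and \<alpha>: "0 < \<alpha>" and R: "0 \<le> R"
  obtains v where "continuous_on {0..} v" "\<And>r. 0 \<le> r \<Longrightarrow> \<alpha> \<le> v r"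
    "\<And>y r. continuous_on {0..} y \<Longrightarrow> (\<And>t. 0 \<le> t \<Longrightarrow> \<alpha> \<le> y t) \<Longrightarrow>
      (\<And>t. 0 \<le> t \<Longrightarrow> t \<le> R \<Longrightarrow> y t \<le> v t) \<Longrightarrow> 0 \<le> r \<Longrightarrow> r \<le> R \<Longrightarrow> picard \<alpha> y r \<le> v r"
proof -
  have "compact (a0 ` {0..R})"
    using a0_continuous by (intro compact_continuous_image) (auto intro: continuous_on_subset)
  then obtain M where M: "\<And>t. 0 \<le> t \<Longrightarrow> t \<le> R \<Longrightarrow> a0 t \<le> M"
    using compact_imp_bounded bounded_real by (metis abs_le_D1 atLeastAtMost_iff imageI)
  have M0: "0 \<le> M" using M[of 0] a0_nonneg[of 0] R by linarith
  \<comment> \<open>The second entry gives \<open>M \<le> l1 * C\<close>, needed for the growth of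
    \<open>h (w (v r))\<close>; the first gives \<open>w \<le> C * w\<close>, needed to pass from
    the slope bound \<open>w (v s)\<close> to the derivative of \<open>v\<close>.\<close>
  define C where "C = max 1 (M / l1)"
  have C: "1 \<le> C" "M \<le> l1 * C" using l1_pos by (auto simp: C_def max_def field_simps)
  \<comment> \<open>\<open>H x\<close> is the time in which the solution of v' = C w(v) climbs from
    \<alpha> to x. Divergence of the integral makes it unbounded, so its inverse \<open>v\<close>
    exists for all times.\<close>
  define H where "H x = integral {\<alpha>..x} (\<lambda>t. 1 / w t) / C" for x
  have H_DERIV: "(H has_real_derivative 1 / (C * w x)) (at x within {\<alpha>..})" if "\<alpha> \<le> x" for x
    unfolding H_def
    using DERIV_cdivide[OF integral_DERIV_atLeast[OF inverse_w_continuous[OF \<alpha>] that], of C] C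
    by (simp add: mult.commute)
  have H_cont: "continuous_on {\<alpha>..} H"
    using H_DERIV by (rule has_real_derivative_imp_continuous_on_atLeast)
  have H_at: "DERIV H x :> 1 / (C * w x)" "0 < 1 / (C * w x)" if "\<alpha> < x" for x
    using that has_real_derivative_atLeast_interior[OF H_DERIV that] \<alpha> C w_pos[of x] by auto
  have H_mono: "strict_mono_on {\<alpha>..} H"
  proof (rule strict_mono_onI)
    fix r s assume rs: "r \<in> {\<alpha>..}" "s \<in> {\<alpha>..}" "r < s"
    show "H r < H s"
    proof (rule DERIV_pos_imp_increasing_open[OF rs(3)])
      show "continuous_on {r..s} H" using rs by (intro continuous_on_subset[OF H_cont]) auto
      fix x assume "r < x" "x < s"
      then have "\<alpha> < x" using rs by auto
      then show "\<exists>y. DERIV H x :> y \<and> 0 < y" using H_at by blast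
    qed
  qed
  have H_top: "filterlim H at_top at_top"
    unfolding H_def using integral_inverse_w_at_top[OF KO \<alpha>] C
    by (auto simp: divide_inverse intro!: filterlim_at_top_mult_tendsto_pos[OF tendsto_const])
  define v where "v = inv_into {\<alpha>..} H"
  have vH: "v (H t) = t" if "\<alpha> \<le> t" for t
    using strict_mono_on_imp_inj_on[OF H_mono] that by (simp add: v_def)
  have H\<alpha>: "H \<alpha> = 0" by (simp add: H_def)
  note v_facts = half_line_inverse[OF H_cont H_mono H_top vH, unfolded H\<alpha>]
  have v_ge: "\<alpha> \<le> v r" if "0 \<le> r" for r using v_facts(1) that by blast
  have v_cont: "continuous_on {0..} v" using v_facts(3) .
  have v_DERIV: "DERIV v r :> C * w (v r)" if r: "0 < r" for r
  proof -
    have "v r \<noteq> \<alpha>" using v_facts(2)[of r] r H\<alpha> by force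
    then have "\<alpha> < v r" using v_ge[of r] r by simp
    then have "DERIV v r :> inverse (1 / (C * w (v r)))"
      by (intro v_facts(5)) (use r H_at[of "v r"] in auto)
    then show ?thesis by simp
  qed
  have v0: "v 0 = \<alpha>" using vH[of \<alpha>] H\<alpha> by simp
  have fv: "continuous_on {0..} (\<lambda>t. f (v t))"
    using v_ge \<alpha> by (intro continuous_on_compose2[OF f_continuous v_cont]) (auto, force)
  have wv: "continuous_on {0..} (\<lambda>t. w (v t))"
    using v_ge \<alpha> by (intro continuous_on_compose2[OF w_continuous v_cont]) (auto, force)
  have wv_pos: "0 < w (v r)" if "0 \<le> r" for r using w_pos v_ge[OF that] \<alpha> by simp
  \<comment> \<open>With X = \<open>w (v r)\<close>, the chain rule gives \<open>h (w (v r))\<close>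
    the derivative C f(v r) times \<open>deriv h X * X / h X\<close>, and the last factor is at
    least \<open>l1\<close>. At r = 0 the left side vanishes.\<close>
  have key: "M * integral {0..r} (\<lambda>t. f (v t)) \<le> h (w (v r))" if r: "0 \<le> r" for r
  proof -
    define D where "D r = h (w (v r)) - M * integral {0..r} (\<lambda>t. f (v t))" for r
    have "D 0 \<le> D r"
    proof (rule DERIV_nonneg_imp_increasing_open[OF r])
      have "continuous_on {0..} (\<lambda>r. h (w (v r)))"
        using wv_pos by (intro continuous_on_compose2[OF h_continuous wv]) (auto simp: less_imp_le)
      moreover have "continuous_on {0..} (\<lambda>r. integral {0..r} (\<lambda>t. f (v t)))"
        by (rule has_real_derivative_imp_continuous_on_atLeast[OF integral_DERIV_atLeast[OF fv]])
      ultimately have "continuous_on {0..} D" unfolding D_def by (intro continuous_intros)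
      then show "continuous_on {0..r} D" by (rule continuous_on_subset) auto
      fix x assume x: "0 < x" "x < r"
      define X where "X = w (v x)"
      have X: "0 < X" using wv_pos[of x] x by (simp add: X_def)
      have vx: "0 < v x" using v_ge[of x] \<alpha> x by simp
      have "DERIV (\<lambda>x. h (w (v x))) x :> deriv h X * (f (v x) / h X * (C * X))"
        using DERIV_chain2[OF h_DERIV[OF X, unfolded X_def] DERIV_chain2[OF w_DERIV[OF vx] v_DERIV[OF x(1)]]]
        by (simp add: X_def)
      moreover have "DERIV (\<lambda>r. integral {0..r} (\<lambda>t. f (v t))) x :> f (v x)"
        using has_real_derivative_atLeast_interior[OF integral_DERIV_atLeast[OF fv]] x by simp
      ultimately have "DERIV D x :> deriv h X * (f (v x) / h X * (C * X)) - M * f (v x)"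
        unfolding D_def by (intro DERIV_diff DERIV_cmult)
      moreover have "M * f (v x) \<le> deriv h X * (f (v x) / h X * (C * X))"
      proof -
        have "l1 \<le> deriv h X * X / h X" using l1_h_le[OF X] h_pos[OF X] by (simp add: field_simps)
        then have "M * f (v x) \<le> deriv h X * X / h X * C * f (v x)"
          using C f_pos[OF vx] by (intro mult_right_mono order.trans[OF C(2)]) auto
        then show ?thesis by (simp add: mult_ac)
      qed
      ultimately show "\<exists>y. DERIV D x :> y \<and> 0 \<le> y" by (metis diff_ge_0_iff_ge)
    qed
    moreover have "0 \<le> D 0" using h_nonneg wv_pos[of 0] by (simp add: D_def)
    ultimately show ?thesis by (simp add: D_def)
  qed
  have "picard \<alpha> y r \<le> v r"
    if y: "continuous_on {0..} y" "\<And>t. 0 \<le> t \<Longrightarrow> \<alpha> \<le> y t"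
      and yv: "\<And>t. 0 \<le> t \<Longrightarrow> t \<le> R \<Longrightarrow> y t \<le> v t" and r: "0 \<le> r" "r \<le> R" for y r
  proof -
    have y0: "0 \<le> y t" if "0 \<le> t" for t using y(2)[OF that] \<alpha> by simp
    have "((\<lambda>s. C * w (v s)) has_integral v r - v 0) {0..r}"
      using v_DERIV r continuous_on_subset[OF v_cont, of "{0..r}"]
      by (intro fundamental_theorem_of_calculus_interior)
         (auto simp: has_real_derivative_iff_has_vector_derivative)
    then have v_int: "v r - \<alpha> = integral {0..r} (\<lambda>s. C * w (v s))"
      using v0 by (metis integral_unique)
    have "integral {0..r} (\<lambda>s. h_inv \<phi> (source y s)) \<le> integral {0..r} (\<lambda>s. C * w (v s))"
    proof (rule integral_le)
      fix s assume s: "s \<in> {0..r}"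
      \<comment> \<open>Dropping the weight here is what allows the supersolution to come from an
        autonomous first-order equation.\<close>
      have "source y s \<le> integral {0..s} (\<lambda>t. M * f (v t))"
        unfolding source_def
      proof (intro radial_mean_le_integral a0_f_continuous)
        fix t assume t: "0 \<le> t" "t \<le> s"
        show "a0 t * f (y t) \<le> M * f (v t)"
          using t s r y0 yv M M0 by (intro mult_mono f_mono f_nonneg) auto
        show "0 \<le> M * f (v t)"
          using M0 f_nonneg[of "v t"] v_ge[of t] \<alpha> t by simp
      qed (use y y0 fv s in \<open>auto intro!: continuous_intros\<close>)
      also have "\<dots> \<le> h (w (v s))" using key[of s] s by simp
      finally have "h_inv \<phi> (source y s) \<le> w (v s)"
        using s source_nonneg[OF y(1) y0, of s] wv_pos[of s] by (intro h_inv_le) auto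
      also have "\<dots> \<le> C * w (v s)" using C wv_pos[of s] s by simp
      finally show "h_inv \<phi> (source y s) \<le> C * w (v s)" .
    qed (use slope_continuous[OF y(1) y0] wv in
        \<open>auto intro!: continuous_on_atLeast_integrable[of 0] continuous_intros\<close>)
    then show ?thesis using v_int by (simp add: picard_def)
  qed
  with v_cont v_ge show ?thesis using that by blast
qed

text \<open>Monotone iteration from the constant \<open>\<alpha>\<close>: since \<open>f\<close> is non-decreasing the iterates increase,
  and they stay below every supersolution.\<close>

lemma fixed_point_exists:
  assumes KO: "\<And>B. \<exists>x\<ge>1. B < integral {1..x} (\<lambda>t. 1 / w t)" and \<alpha>: "0 < \<alpha>"
  obtains u where "continuous_on {0..} u" "\<And>r. 0 \<le> r \<Longrightarrow> \<alpha> \<le> u r" "\<And>r. 0 \<le> r \<Longrightarrow> u r = picard \<alpha> u r"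
proof -
  define U where "U k = (picard \<alpha> ^^ k) (\<lambda>_. \<alpha>)" for k
  have U0: "U 0 = (\<lambda>_. \<alpha>)" and US: "U (Suc k) = picard \<alpha> (U k)" for k by (auto simp: U_def)
  have U_ok: "continuous_on {0..} (U k) \<and> (\<forall>t\<ge>0. \<alpha> \<le> U k t)" for k
  proof (induction k)
    case (Suc k)
    have "0 \<le> U k t" if "0 \<le> t" for t using Suc that \<alpha> by (meson less_le_trans less_imp_le)
    then show ?case using picard_continuous[of "U k" \<alpha>] picard_ge[of "U k"] Suc by (auto simp: US)
  qed (simp add: U0)
  then have U_cont: "continuous_on {0..} (U k)" and U_ge: "0 \<le> t \<Longrightarrow> \<alpha> \<le> U k t" for k t by auto
  have U_nn: "0 \<le> t \<Longrightarrow> 0 \<le> U k t" for k t using U_ge[of t k] \<alpha> by simp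
  have U_Suc: "0 \<le> t \<Longrightarrow> U k t \<le> U (Suc k) t" for k t
  proof (induction k arbitrary: t)
    case 0
    then show ?case using U_ge[of t 1] by (simp add: U0)
  next
    case (Suc k)
    then have "picard \<alpha> (U k) t \<le> picard \<alpha> (U (Suc k)) t"
      by (intro picard_mono U_cont U_nn) auto
    then show ?case by (simp only: US)
  qed
  \<comment> \<open>The iterates do not depend on R. Only the bound does, through the maximum of
    \<open>a0\<close> on [0, R], and one bound for each R is enough.\<close>
  have U_bound: "\<exists>v. continuous_on {0..} v \<and> (\<forall>r\<ge>0. \<alpha> \<le> v r) \<and> (\<forall>k. \<forall>r\<in>{0..R}. U k r \<le> v r)"
    if R: "0 \<le> R" for R
  proof -
    obtain v where v: "continuous_on {0..} v" "\<And>r. 0 \<le> r \<Longrightarrow> \<alpha> \<le> v r"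
      "\<And>y r. continuous_on {0..} y \<Longrightarrow> (\<And>t. 0 \<le> t \<Longrightarrow> \<alpha> \<le> y t) \<Longrightarrow>
        (\<And>t. 0 \<le> t \<Longrightarrow> t \<le> R \<Longrightarrow> y t \<le> v t) \<Longrightarrow> 0 \<le> r \<Longrightarrow> r \<le> R \<Longrightarrow> picard \<alpha> y r \<le> v r"
      using supersolution_exists[OF KO \<alpha> R] by metis
    have "U k r \<le> v r" if "0 \<le> r" "r \<le> R" for k r
      using that
    proof (induction k arbitrary: r)
      case 0
      then show ?case using v(2) by (simp add: U0)
    next
      case (Suc k)
      then show ?case unfolding US by (intro v(3) U_cont U_ge) auto
    qed
    then show ?thesis using v by auto
  qed
  define u where "u r = (SUP k. U k r)" for r
  have U_lim: "(\<lambda>k. U k r) \<longlonglongrightarrow> u r" if r: "0 \<le> r" for r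
    unfolding u_def
  proof (rule LIMSEQ_incseq_SUP)
    obtain v where "\<forall>k. \<forall>s\<in>{0..r}. U k s \<le> v s" using U_bound[OF r] by blast
    then show "bdd_above (range (\<lambda>k. U k r))" using r by (intro bdd_aboveI2[where M="v r"]) auto
    show "incseq (\<lambda>k. U k r)" using U_Suc[OF r] by (rule incseq_SucI)
  qed
  have u_ge: "\<alpha> \<le> u r" if r: "0 \<le> r" for r
    using U_ge[OF r] by (intro LIMSEQ_le_const[OF U_lim[OF r]]) auto
  \<comment> \<open>Dominated convergence is used twice, inside \<open>source\<close> and for the
    outer integral, with majorants built from the supersolution. Integrability is kept in the
    conclusion because \<open>u\<close> is not yet known to be continuous.\<close>
  have fixed: "(\<lambda>s. h_inv \<phi> (source u s)) integrable_on {0..R} \<and> u R = picard \<alpha> u R" if R: "0 \<le> R" for R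
  proof -
    obtain v where v: "continuous_on {0..} v" "\<forall>r\<ge>0. \<alpha> \<le> v r" "\<forall>k. \<forall>s\<in>{0..R}. U k s \<le> v s"
      using U_bound[OF R] by blast
    have v0: "0 \<le> v r" if "0 \<le> r" for r using v(2) that \<alpha> by (meson less_le_trans less_imp_le)
    have src: "(\<lambda>k. source (U k) s) \<longlonglongrightarrow> source u s" if s: "s \<in> {0..R}" for s
      unfolding source_def radial_mean_def divide_inverse
    proof (rule tendsto_mult[OF dominated_convergence(2)[where h="\<lambda>t. t ^ n * (a0 t * f (v t))"] tendsto_const])
      show "(\<lambda>t. t ^ n * (a0 t * f (U k t))) integrable_on {0..s}" for k
        by (intro continuous_on_atLeast_integrable[of 0] power_mult_continuous a0_f_continuous U_cont U_nn) auto
      show "(\<lambda>t. t ^ n * (a0 t * f (v t))) integrable_on {0..s}"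
        by (intro continuous_on_atLeast_integrable[of 0] power_mult_continuous a0_f_continuous v v0) auto
      fix t assume t: "t \<in> {0..s}"
      show "norm (t ^ n * (a0 t * f (U k t))) \<le> t ^ n * (a0 t * f (v t))" for k
      proof -
        have "f (U k t) \<le> f (v t)" using v(3) t s U_nn by (intro f_mono) auto
        then have "t ^ n * (a0 t * f (U k t)) \<le> t ^ n * (a0 t * f (v t))"
          using t a0_nonneg[of t] by (intro mult_left_mono) auto
        then show ?thesis using t a0_nonneg[of t] f_nonneg[OF U_nn, of t k] by simp
      qed
      have "(\<lambda>k. f (U k t)) \<longlonglongrightarrow> f (u t)"
        using t U_nn u_ge[of t] \<alpha>
        by (intro continuous_on_tendsto_compose[OF f_continuous U_lim]) auto
      then show "(\<lambda>k. t ^ n * (a0 t * f (U k t))) \<longlonglongrightarrow> t ^ n * (a0 t * f (u t))"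
        by (intro tendsto_intros)
    qed
    have slope: "(\<lambda>k. h_inv \<phi> (source (U k) s)) \<longlonglongrightarrow> h_inv \<phi> (source u s)" if s: "s \<in> {0..R}" for s
    proof (rule continuous_on_tendsto_compose[OF h_inv_continuous src[OF s]])
      have 0: "0 \<le> source (U k) s" for k using s by (intro source_nonneg U_cont U_nn) auto
      then show "\<forall>\<^sub>F k in sequentially. source (U k) s \<in> {0..}" by simp
      show "source u s \<in> {0..}" using LIMSEQ_le_const[OF src[OF s]] 0 by auto
    qed
    have bound: "norm (h_inv \<phi> (source (U k) s)) \<le> h_inv \<phi> (source v s)" if s: "s \<in> {0..R}" for k s
    proof -
      have "0 \<le> source (U k) s" using s by (intro source_nonneg U_cont U_nn) auto
      moreover have "source (U k) s \<le> source v s"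
        using s v by (intro source_mono U_cont U_nn v0) auto
      ultimately show ?thesis using h_inv_mono h_inv_nonneg by simp
    qed
    have int: "(\<lambda>s. h_inv \<phi> (source (U k) s)) integrable_on {0..R}" for k
      by (intro continuous_on_atLeast_integrable[of 0] slope_continuous U_cont U_nn) auto
    have intv: "(\<lambda>s. h_inv \<phi> (source v s)) integrable_on {0..R}"
      by (intro continuous_on_atLeast_integrable[of 0] slope_continuous v v0) auto
    note dc = dominated_convergence[OF int intv bound slope]
    have "(\<lambda>k. U (Suc k) R) \<longlonglongrightarrow> picard \<alpha> u R"
      unfolding US picard_def using dc(2) by (intro tendsto_intros)
    moreover have "(\<lambda>k. U (Suc k) R) \<longlonglongrightarrow> u R"
      using U_lim[OF R] by (rule LIMSEQ_Suc)
    ultimately show ?thesis using dc(1) LIMSEQ_unique by blast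
  qed
  \<comment> \<open>A pointwise increasing limit of continuous functions need not be continuous;
    this one is, being an indefinite integral on every bounded interval.\<close>
  have "continuous_on {0..} u"
    unfolding continuous_on_eq_continuous_within
  proof
    fix r :: real assume r: "r \<in> {0..}"
    have "continuous_on {0..r+1} (\<lambda>s. \<alpha> + integral {0..s} (\<lambda>s. h_inv \<phi> (source u s)))"
      using fixed[of "r+1"] r by (intro continuous_intros indefinite_integral_continuous_1) auto
    then have "continuous_on {0..r+1} u"
      by (rule continuous_on_eq) (use fixed in \<open>auto simp: picard_def\<close>)
    moreover have "at r within {0..} = at r within {0..r+1}"
      by (rule at_within_nhd[of r "{..<r+1}"]) (use r in auto)
    ultimately show "continuous (at r within {0..}) u"
      using r unfolding continuous_on_eq_continuous_within by auto
  qed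
  then show ?thesis using that u_ge fixed by blast
qed

lemma profile_exists:
  assumes KO: "\<And>B. \<exists>x\<ge>1. B < integral {1..x} (\<lambda>t. 1 / w t)" and \<alpha>: "0 < \<alpha>"
  obtains u where "u 0 = \<alpha>" "\<And>r. 0 \<le> r \<Longrightarrow> \<alpha> \<le> u r"
    "\<And>r. 0 \<le> r \<Longrightarrow> (u has_real_derivative h_inv \<phi> (source u r)) (at r within {0..})"
proof -
  obtain u where u: "continuous_on {0..} u" "\<And>r. 0 \<le> r \<Longrightarrow> \<alpha> \<le> u r" "\<And>r. 0 \<le> r \<Longrightarrow> u r = picard \<alpha> u r"
    using fixed_point_exists[OF KO \<alpha>] by metis
  have "(u has_real_derivative h_inv \<phi> (source u r)) (at r within {0..})" if r: "0 \<le> r" for r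
  proof -
    have "(picard \<alpha> u has_real_derivative h_inv \<phi> (source u r)) (at r within {0..})"
      using u r \<alpha> by (intro picard_DERIV) (auto intro: order.trans[of 0 \<alpha>])
    then show ?thesis
      by (rule has_field_derivative_transform_within[of _ _ _ _ 1]) (use r u in auto)
  qed
  moreover have "u 0 = \<alpha>" using u(3)[of 0] by (simp add: picard_def)
  ultimately show ?thesis using that u by blast
qed

end

section \<open>Convergent Keller-Osserman integral\<close>

context radial_problem begin

section \<open>Growth of w and f when the integral converges\<close>

lemma F_le: "0 \<le> t \<Longrightarrow> F t \<le> t * f t"
proof -
  assume t: "0 \<le> t"
  have "F t \<le> integral {0..t} (\<lambda>_. f t)"
    unfolding F_def using f_mono
    by (intro integral_le continuous_on_atLeast_integrable[OF f_continuous]) auto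
  then show ?thesis using t by simp
qed

text \<open>Monotonicity of \<open>f\<close> makes F(2t) - 2F(t) non-decreasing. This is why
  doubling is awaited below: afterwards at least half of F(u) survives the subtraction of its
  initial value.\<close>

lemma F_double: "0 \<le> t \<Longrightarrow> 2 * t \<le> s \<Longrightarrow> 2 * F t \<le> F s"
proof -
  assume t: "0 \<le> t" "2 * t \<le> s"
  have "F (2 * 0) - 2 * F 0 \<le> F (2 * t) - 2 * F t"
  proof (rule DERIV_nonneg_imp_increasing_open[OF t(1)])
    show "continuous_on {0..t} (\<lambda>t. F (2 * t) - 2 * F t)"
      by (intro continuous_intros continuous_on_compose2[OF F_continuous]) auto
    fix x assume x: "0 < x" "x < t"
    have "DERIV (\<lambda>t. F (2 * t) - 2 * F t) x :> f (2 * x) * 2 - 2 * f x"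
      using x by (intro DERIV_diff DERIV_cmult DERIV_chain2[of F] F_DERIV)
        (auto intro!: derivative_eq_intros)
    moreover have "f x \<le> f (2 * x)" using x by (intro f_mono) auto
    ultimately show "\<exists>y. DERIV (\<lambda>t. F (2 * t) - 2 * F t) x :> y \<and> 0 \<le> y" by force
  qed
  then show ?thesis using F_mono[of "2 * t" s] t by simp
qed

lemma integral_inverse_w_tail:
  assumes conv: "\<And>x. 1 \<le> x \<Longrightarrow> integral {1..x} (\<lambda>t. 1 / w t) \<le> B" and \<epsilon>: "0 < \<epsilon>"
  obtains R where "1 \<le> R" "\<And>x y. R \<le> y \<Longrightarrow> y \<le> x \<Longrightarrow> integral {y..x} (\<lambda>t. 1 / w t) < \<epsilon>"
proof -
  define J where "J x = integral {1..x} (\<lambda>t. 1 / w t)" for x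
  note int = continuous_on_atLeast_integrable[OF inverse_w_continuous[of 1]]
  have comb: "J y + integral {y..x} (\<lambda>t. 1 / w t) = J x" if "1 \<le> y" "y \<le> x" for x y
    unfolding J_def using that int by (intro Henstock_Kurzweil_Integration.integral_combine) auto
  have nn: "0 \<le> integral {y..x} (\<lambda>t. 1 / w t)" if "1 \<le> y" for x y
    using that int[of y x] w_pos by (intro Henstock_Kurzweil_Integration.integral_nonneg) (auto simp: less_imp_le)
  have bdd: "bdd_above (J ` {1..})" using conv by (intro bdd_aboveI2[where M=B]) (auto simp: J_def)
  define S where "S = (SUP x\<in>{1..}. J x)"
  have "\<exists>R\<in>{1..}. S - \<epsilon> < J R"
    using less_cSUP_iff[of "{1..}" J "S - \<epsilon>"] bdd \<epsilon> by (simp add: S_def)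
  then obtain R where R: "1 \<le> R" "S - \<epsilon> < J R" by auto
  have "integral {y..x} (\<lambda>t. 1 / w t) < \<epsilon>" if "R \<le> y" "y \<le> x" for x y
  proof -
    have "J x \<le> S" using cSUP_upper[OF _ bdd, of x] R that by (simp add: S_def)
    moreover have "J R \<le> J y" using comb[of R y] nn[of R y] R that by simp
    ultimately show ?thesis using comb[of y x] R that by simp
  qed
  with R show ?thesis using that by blast
qed

text \<open>Since \<open>1 / w\<close> is non-increasing, its integral over [t/2, t] is at least t /
  (2 w(t)), and the tails of a convergent integral become arbitrarily small.\<close>

lemma w_superlinear:
  assumes conv: "\<And>x. 1 \<le> x \<Longrightarrow> integral {1..x} (\<lambda>t. 1 / w t) \<le> B" and K: "0 < K"
  obtains R where "1 \<le> R" "\<And>t. R \<le> t \<Longrightarrow> K * t \<le> w t"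
proof -
  obtain S where S: "1 \<le> S" "\<And>x y. S \<le> y \<Longrightarrow> y \<le> x \<Longrightarrow> integral {y..x} (\<lambda>t. 1 / w t) < 1 / (2 * K)"
    using integral_inverse_w_tail[OF conv, of "1 / (2 * K)"] K by auto
  have "K * t \<le> w t" if t: "2 * S \<le> t" for t
  proof -
    have t0: "0 < t" "0 < w t" using t S w_pos[of t] by auto
    have "integral {t/2..t} (\<lambda>_. 1 / w t) \<le> integral {t/2..t} (\<lambda>t. 1 / w t)"
      using t S w_mono w_pos
      by (intro integral_le continuous_on_atLeast_integrable[OF inverse_w_continuous[of 1]])
         (auto intro!: divide_left_mono)
    also have "\<dots> < 1 / (2 * K)" using t S by (intro S(2)) auto
    finally have "t / 2 / w t < 1 / (2 * K)" using t0 by simp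
    then show ?thesis using t0 K by (simp add: field_simps)
  qed
  with S(1) show ?thesis by (intro that[of "2 * S"]) auto
qed

text \<open>Carries the growth of \<open>w\<close> over to \<open>f\<close>: h(Lt) L t \<le> m
  \<Phi>(Lt) \<le> m \<Phi>(w t) = m F(t) \<le> m t f(t). Taking L \<ge> m absorbs the factor m, and
  cancelling L t leaves h(Lt) \<le> f(t).\<close>

lemma h_inv_f_superlinear:
  assumes conv: "\<And>x. 1 \<le> x \<Longrightarrow> integral {1..x} (\<lambda>t. 1 / w t) \<le> B" and K: "0 < K"
  obtains R where "1 \<le> R" "\<And>t. R \<le> t \<Longrightarrow> K * t \<le> h_inv \<phi> (f t)"
proof -
  define L where "L = max K m"
  have L: "K \<le> L" "m \<le> L" "0 < L" using K by (auto simp: L_def)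
  obtain R where R: "1 \<le> R" "\<And>t. R \<le> t \<Longrightarrow> L * t \<le> w t"
    using w_superlinear[OF conv L(3)] by blast
  have "K * t \<le> h_inv \<phi> (f t)" if t: "R \<le> t" for t
  proof -
    have t0: "0 < t" using t R by simp
    have "h (L * t) * (L * t) \<le> m * Phi \<phi> (L * t)" using le_m_Phi[of "L * t"] L t0 by simp
    also have "\<dots> \<le> m * Phi \<phi> (w t)"
      using R(2)[OF t] L t0 m_gt by (intro mult_left_mono Phi_mono) auto
    also have "\<dots> = m * F t" using F_nonneg t0 by (simp add: w_def Phi_Phi_inv)
    also have "\<dots> \<le> m * (t * f t)" using F_le[of t] t0 m_gt by simp
    also have "\<dots> \<le> L * (t * f t)" using L f_pos[OF t0] t0 by (intro mult_right_mono) auto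
    finally have "h (L * t) * (L * t) \<le> f t * (L * t)" by (simp add: mult_ac)
    then have "h (L * t) \<le> f t" using L t0 by simp
    then have "L * t \<le> h_inv \<phi> (f t)" using L t0 by (intro le_h_inv) auto
    then show ?thesis using L t0 by (meson mult_right_mono less_imp_le order_trans)
  qed
  with R(1) show ?thesis using that by blast
qed

text \<open>The Legendre transform of \<Phi> at \<open>q\<close>: the supremum of s q - \<Phi>(s)
  over s \<ge> 0 is attained at s = \<open>h_inv \<phi> q\<close>, which is therefore the
  derivative. In the flux variable no derivative of u' is needed.\<close>

definition energy :: "real \<Rightarrow> real" where "energy q = h_inv \<phi> q * q - Phi \<phi> (h_inv \<phi> q)"

lemma energy_DERIV: "0 < q \<Longrightarrow> DERIV energy q :> h_inv \<phi> q"
proof -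
  assume q: "0 < q"
  define D where "D = inverse (deriv h (h_inv \<phi> q))"
  have "DERIV (\<lambda>q. Phi \<phi> (h_inv \<phi> q)) q :> q * D"
    using DERIV_chain2[OF Phi_DERIV[OF h_inv_pos[OF q]] h_inv_DERIV[OF q]] q
    by (simp add: h_h_inv D_def)
  moreover have "DERIV (h_inv \<phi>) q :> D" using h_inv_DERIV[OF q] by (simp add: D_def)
  ultimately have "DERIV energy q :> (D * q + 1 * h_inv \<phi> q) - q * D"
    unfolding energy_def by (intro DERIV_diff DERIV_mult DERIV_ident)
  then show ?thesis by simp
qed

lemma energy_nonneg: "0 < q \<Longrightarrow> 0 \<le> energy q"
proof -
  assume q: "0 < q"
  have "1 * Phi \<phi> (h_inv \<phi> q) \<le> l * Phi \<phi> (h_inv \<phi> q)"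
    using l_gt Phi_pos[OF h_inv_pos[OF q]] by (intro mult_right_mono) auto
  also have "\<dots> \<le> h_inv \<phi> q * q"
    using l_Phi_le[OF h_inv_pos[OF q]] h_h_inv[of q] q by (simp add: mult.commute)
  finally show ?thesis by (simp add: energy_def)
qed

text \<open>The upper bound \<open>m\<close> at t = \<open>h_inv \<phi> q\<close>. It turns a lower
  bound for the energy into one for \<Phi> of the slope.\<close>

lemma energy_le: "0 < q \<Longrightarrow> energy q \<le> (m - 1) * Phi \<phi> (h_inv \<phi> q)"
  using le_m_Phi[OF h_inv_pos, of q] h_h_inv[of q] by (simp add: energy_def algebra_simps)

lemma profile_facts:
  assumes u: "\<And>r. 0 \<le> r \<Longrightarrow> (u has_real_derivative h_inv \<phi> (source u r)) (at r within {0..})"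
    and pos: "\<And>r. 0 \<le> r \<Longrightarrow> 0 < u r"
  shows profile_continuous: "continuous_on {0..} u"
    and profile_source_nonneg: "\<And>r. 0 \<le> r \<Longrightarrow> 0 \<le> source u r"
    and profile_mono: "\<And>r s. 0 \<le> r \<Longrightarrow> r \<le> s \<Longrightarrow> u r \<le> u s"
proof -
  show cont: "continuous_on {0..} u"
    using u by (rule has_real_derivative_imp_continuous_on_atLeast)
  show nn: "0 \<le> source u r" if "0 \<le> r" for r
    using pos that by (intro source_nonneg cont) (auto simp: less_imp_le)
  show "u r \<le> u s" if "0 \<le> r" "r \<le> s" for r s
  proof (rule DERIV_nonneg_imp_increasing_open[OF that(2)])
    show "continuous_on {r..s} u" using that by (intro continuous_on_subset[OF cont]) auto
    fix x assume "r < x" "x < s"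
    then have x: "0 < x" using that by simp
    show "\<exists>y. DERIV u x :> y \<and> 0 \<le> y"
      using has_real_derivative_atLeast_interior[OF u x] x h_inv_nonneg[OF nn] by force
  qed
qed

text \<open>Where \<open>a0 \<ge> c > 0\<close>, the energy estimate gives \<open>u' \<ge> const * w(u)\<close> as soon as \<open>u\<close> has doubled,
  and \<open>u\<close> doubles quickly if it is large; so a large \<open>u\<close> would have to blow up.\<close>

lemma profile_initial_bound:
  assumes conv: "\<And>x. 1 \<le> x \<Longrightarrow> integral {1..x} (\<lambda>t. 1 / w t) \<le> B"
    and r: "0 < r" "0 < a0 r"
  obtains \<beta> where "\<And>u. (\<And>r. 0 \<le> r \<Longrightarrow> 0 < u r) \<Longrightarrow>
    (\<And>r. 0 \<le> r \<Longrightarrow> (u has_real_derivative h_inv \<phi> (source u r)) (at r within {0..})) \<Longrightarrow> u 0 < \<beta>"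
proof -
  define c where "c = a0 r / 2"
  have c: "0 < c" using r by (simp add: c_def)
  have "isCont a0 r"
    using a0_continuous r by (simp add: continuous_on_interior interior_real_atLeast)
  then have "\<forall>\<^sub>F t in at r. c < a0 t"
    unfolding isCont_def using r by (intro order_tendstoD) (auto simp: c_def)
  then obtain \<delta> where \<delta>: "0 < \<delta>" "\<And>t. t \<noteq> r \<Longrightarrow> dist t r < \<delta> \<Longrightarrow> c < a0 t"
    by (auto simp: eventually_at)
  \<comment> \<open>The interval [r, r + 4d] stays within half of \<delta>. Its four pieces serve in
    turn to make the flux positive, to build it up to size c d f(u), to let \<open>u\<close> double,
    and to let the life span run out.\<close>
  define d where "d = \<delta> / 8"
  define r1 where "r1 = r + 4 * d"
  have d: "0 < d" using \<delta> by (simp add: d_def)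
  have a0_ge: "c \<le> a0 t" if "r \<le> t" "t \<le> r1" for t
    using \<delta>(2)[of t] that \<delta>(1) r by (cases "t = r") (auto simp: r1_def d_def c_def dist_real_def)
  \<comment> \<open>The price of freezing the weight: (r/s)^n is at least (r/r1)^n on the interval,
    and \<open>h_inv_scale\<close> converts this factor into one on the slope.\<close>
  define \<kappa> where "\<kappa> = ((r / r1) ^ n) powr (1 / l1)"
  have rr: "0 < (r / r1) ^ n" "(r / r1) ^ n \<le> 1" using r d by (auto simp: r1_def intro!: power_le_one)
  have \<kappa>: "0 < \<kappa>" using rr(1) unfolding \<kappa>_def by (metis less_irrefl powr_gt_zero)
  \<comment> \<open>Obtained by pulling c d, the flux accumulated per unit of f(u) over one piece,
    out of \<open>h_inv\<close>; the minimum with 1 meets the side condition of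
    \<open>h_inv_scale\<close>.\<close>
  define \<nu> where "\<nu> = (min 1 (c * d)) powr (1 / l1)"
  have \<nu>: "0 < \<nu>"
    using c d unfolding \<nu>_def by (auto simp: min_def)
  \<comment> \<open>Here c bounds \<open>a0\<close> from below, m - 1 comes from
    \<open>energy_le\<close>, and the 2 from \<open>F_double\<close>. The minimum with 1 is required
    by \<open>Phi_inv_scale\<close>.\<close>
  define \<mu> where "\<mu> = min 1 (c / (2 * (m - 1)))"
  have \<mu>: "0 < \<mu>" "\<mu> \<le> 1" using c m_gt by (auto simp: \<mu>_def)
  \<comment> \<open>Above \<open>R1\<close> the remaining tail of the integral is less than the
    amount \<kappa> \<mu> d gained over one piece; above \<open>R2\<close> one piece is long enough
    for \<open>u\<close> to double.\<close>
  obtain R1 where R1: "1 \<le> R1" "\<And>x y. R1 \<le> y \<Longrightarrow> y \<le> x \<Longrightarrow> integral {y..x} (\<lambda>t. 1 / w t) < \<kappa> * \<mu> * d"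
    using integral_inverse_w_tail[OF conv, of "\<kappa> * \<mu> * d"] \<kappa> \<mu> d by auto
  obtain R2 where R2: "1 \<le> R2" "\<And>t. R2 \<le> t \<Longrightarrow> 1 / (\<kappa> * \<nu> * d) * t \<le> h_inv \<phi> (f t)"
    using h_inv_f_superlinear[OF conv, of "1 / (\<kappa> * \<nu> * d)"] \<kappa> \<nu> d by auto
  define \<beta> where "\<beta> = max R1 R2"
  have "u 0 < \<beta>"
    if pos: "\<And>r. 0 \<le> r \<Longrightarrow> 0 < u r"
      and u: "\<And>r. 0 \<le> r \<Longrightarrow> (u has_real_derivative h_inv \<phi> (source u r)) (at r within {0..})" for u
  proof (rule ccontr)
    assume "\<not> u 0 < \<beta>"
    then have u0: "R1 \<le> u 0" "R2 \<le> u 0" by (auto simp: \<beta>_def)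
    note cont = profile_continuous[OF u pos]
      and src_nn = profile_source_nonneg[OF u pos]
      and mono = profile_mono[OF u pos]
    have u_DERIV: "DERIV u t :> h_inv \<phi> (source u t)" if "0 < t" for t
      using has_real_derivative_atLeast_interior[OF u that] that by simp
    define p where "p s = integral {0..s} (\<lambda>t. t ^ n * (a0 t * f (u t)))" for s
    \<comment> \<open>The flux with its weight frozen at the left end r. Unlike
      \<open>source u\<close> it is non-decreasing, with derivative at least c f(u) on [r, r1]; for
      s \<ge> r it dominates the true flux.\<close>
    define q where "q s = p s / r ^ n" for s
    have pc: "continuous_on {0..} (\<lambda>t. t ^ n * (a0 t * f (u t)))"
      using pos by (intro power_mult_continuous a0_f_continuous cont) (auto simp: less_imp_le)
    have q_DERIV: "DERIV q s :> s ^ n * (a0 s * f (u s)) / r ^ n" if "0 < s" for s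
      unfolding q_def p_def using that
      by (intro DERIV_cdivide has_real_derivative_atLeast_interior[OF integral_DERIV_atLeast[OF pc]]) auto
    have q'_ge: "c * f (u s) \<le> s ^ n * (a0 s * f (u s)) / r ^ n" if s: "r \<le> s" "s \<le> r1" for s
    proof -
      have "r ^ n * (c * f (u s)) \<le> s ^ n * (a0 s * f (u s))"
        using r s a0_ge[OF s] c f_pos[OF pos, of s]
        by (intro mult_mono power_mono) auto
      then show ?thesis using r by (simp add: field_simps)
    qed
    have q_nn: "0 \<le> q r"
      using src_nn[of r] r by (simp add: q_def source_def radial_mean_def p_def)
    have q_cont: "continuous_on {0..} q"
      using has_real_derivative_imp_continuous_on_atLeast[OF integral_DERIV_atLeast[OF pc]] r
      unfolding q_def p_def by (intro continuous_intros) auto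
    have q_ge: "q x + c * f (u x) * (y - x) \<le> q y" if x: "r \<le> x" "x \<le> y" "y \<le> r1" for x y
    proof -
      have "q x - c * f (u x) * x \<le> q y - c * f (u x) * y"
      proof (rule DERIV_nonneg_imp_increasing_open[OF x(2)])
        show "continuous_on {x..y} (\<lambda>s. q s - c * f (u x) * s)"
          using x r by (intro continuous_intros continuous_on_subset[OF q_cont]) auto
        fix s assume s: "x < s" "s < y"
        have "DERIV (\<lambda>s. q s - c * f (u x) * s) s :> s ^ n * (a0 s * f (u s)) / r ^ n - c * f (u x) * 1"
          using s x r by (intro DERIV_diff q_DERIV DERIV_cmult DERIV_ident) auto
        moreover have "c * f (u x) \<le> c * f (u s)"
          using s x r c pos[of x] by (intro mult_left_mono f_mono mono) auto
        ultimately show "\<exists>y. DERIV (\<lambda>s. q s - c * f (u x) * s) s :> y \<and> 0 \<le> y"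
          using q'_ge[of s] s x by (intro exI conjI) auto
      qed
      then show ?thesis by (simp add: algebra_simps)
    qed
    have source_q: "source u s = q s * (r / s) ^ n" for s
      using r by (simp add: source_def radial_mean_def q_def p_def power_divide)
    define ra rb rc where "ra = r + d" and "rb = r + 2 * d" and "rc = r + 3 * d"
    note rdefs = ra_def rb_def rc_def r1_def
    \<comment> \<open>The energy and \<open>h_inv\<close> are differentiated only at positive
      arguments, so the first piece of the interval is given up.\<close>
    have q_pos: "0 < q s" if "ra \<le> s" "s \<le> r1" for s
    proof -
      have "0 < c * f (u r) * (s - r)" using that c d r f_pos[OF pos, of r] by (simp add: rdefs)
      then show ?thesis using q_ge[of r s] that d q_nn by (simp add: rdefs)
    qed
    have slope_le: "h_inv \<phi> (source u s) \<le> h_inv \<phi> (q s)"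
      and slope_ge: "\<kappa> * h_inv \<phi> (q s) \<le> h_inv \<phi> (source u s)" if s: "ra \<le> s" "s \<le> r1" for s
    proof -
      have s0: "0 < s" "r \<le> s" using s d r by (auto simp: rdefs)
      have "(r / s) ^ n \<le> 1" using s0 r by (intro power_le_one) auto
      then have "source u s \<le> q s"
        using q_pos[OF s] mult_left_mono[of "(r / s) ^ n" 1 "q s"] by (simp add: source_q)
      then show "h_inv \<phi> (source u s) \<le> h_inv \<phi> (q s)"
        using src_nn[of s] s0 by (intro h_inv_mono) auto
      have "\<kappa> * h_inv \<phi> (q s) \<le> h_inv \<phi> ((r / r1) ^ n * q s)"
        unfolding \<kappa>_def using rr q_pos[OF s] by (intro h_inv_scale) auto
      also have "\<dots> \<le> h_inv \<phi> (source u s)"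
        unfolding source_q using rr q_pos[OF s] s s0 r
        by (subst mult.commute) (intro h_inv_mono mult_left_mono power_mono divide_left_mono, auto)
      finally show "\<kappa> * h_inv \<phi> (q s) \<le> h_inv \<phi> (source u s)" .
    qed
    have ua: "0 < u ra" using pos r d by (simp add: rdefs)
    have ua0: "u 0 \<le> u ra" using mono[of 0 ra] r d by (simp add: rdefs)
    \<comment> \<open>Doubling. For s beyond \<open>rb\<close> the flux \<open>q s\<close> is at
      least c d f(u(ra)), so the slope is at least \<kappa> \<nu> times
      \<open>h_inv \<phi> (f (u ra))\<close>; over a length d this gains at least
      \<open>u ra\<close>, by the choice of \<open>R2\<close>.\<close>
    have "u ra \<le> \<kappa> * \<nu> * d * h_inv \<phi> (f (u ra))"
      using R2(2)[of "u ra"] u0 ua0 \<kappa> \<nu> d by (simp add: field_simps)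
    also have "\<dots> \<le> u rc - u rb"
    proof -
      have "u rb - \<kappa> * \<nu> * h_inv \<phi> (f (u ra)) * rb \<le> u rc - \<kappa> * \<nu> * h_inv \<phi> (f (u ra)) * rc"
      proof (rule DERIV_nonneg_imp_increasing_open[of rb rc])
        show "rb \<le> rc" using d by (simp add: rdefs)
        show "continuous_on {rb..rc} (\<lambda>s. u s - \<kappa> * \<nu> * h_inv \<phi> (f (u ra)) * s)"
          using r d by (intro continuous_intros continuous_on_subset[OF cont]) (auto simp: rdefs)
        fix s assume s: "rb < s" "s < rc"
        then have s': "ra \<le> s" "s \<le> r1" "0 < s" using d r by (auto simp: rdefs)
        have "DERIV (\<lambda>s. u s - \<kappa> * \<nu> * h_inv \<phi> (f (u ra)) * s) s :>
            h_inv \<phi> (source u s) - \<kappa> * \<nu> * h_inv \<phi> (f (u ra)) * 1"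
          using s' by (intro DERIV_diff u_DERIV DERIV_cmult DERIV_ident) auto
        moreover have "\<kappa> * \<nu> * h_inv \<phi> (f (u ra)) \<le> h_inv \<phi> (source u s)"
        proof -
          have fa: "0 < f (u ra)" using f_pos ua by simp
          have "\<nu> * h_inv \<phi> (f (u ra)) \<le> h_inv \<phi> (min 1 (c * d) * f (u ra))"
            unfolding \<nu>_def using c d fa by (intro h_inv_scale) auto
          also have "\<dots> \<le> h_inv \<phi> (q s)"
          proof (rule h_inv_mono)
            have "min 1 (c * d) * f (u ra) \<le> c * d * f (u ra)" using fa by (intro mult_right_mono) auto
            also have "\<dots> \<le> c * f (u ra) * (s - ra)"
              using s c fa by (simp add: rdefs)
            also have "\<dots> \<le> q s"
              using q_ge[of ra s] q_pos[of ra] s' d by (simp add: rdefs)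
            finally show "min 1 (c * d) * f (u ra) \<le> q s" .
          qed (use c d fa in auto)
          finally have "\<kappa> * (\<nu> * h_inv \<phi> (f (u ra))) \<le> \<kappa> * h_inv \<phi> (q s)" using \<kappa> by simp
          also have "\<dots> \<le> h_inv \<phi> (source u s)" using slope_ge s' by simp
          finally show ?thesis by (simp add: mult_ac)
        qed
        ultimately show "\<exists>y. DERIV (\<lambda>s. u s - \<kappa> * \<nu> * h_inv \<phi> (f (u ra)) * s) s :> y \<and> 0 \<le> y"
          by (intro exI conjI) auto
      qed
      then show ?thesis by (simp add: rdefs algebra_simps)
    qed
    also have "\<dots> \<le> u rc - u ra" using mono[of ra rb] r d by (simp add: rdefs)
    finally have uc: "2 * u ra \<le> u rc" by simp
    \<comment> \<open>The derivative of the energy is \<open>h_inv \<phi> (q s)\<close> times q',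
      hence at least c f(u) u': q' \<ge> c f(u), and u' \<le> \<open>h_inv \<phi> (q s)\<close>
      because the true flux lies below \<open>q\<close>. This is c times the derivative of
      F(u).\<close>
    have energy: "c * (F (u s) - F (u ra)) \<le> energy (q s)" if s: "ra \<le> s" "s \<le> r1" for s
    proof -
      have "energy (q ra) - c * F (u ra) \<le> energy (q s) - c * F (u s)"
      proof (rule DERIV_nonneg_imp_nondecreasing[OF s(1)])
        fix x assume "ra \<le> x" "x \<le> s"
        then have x: "ra \<le> x" "x \<le> r1" "0 < x" "r \<le> x" using s d r by (auto simp: rdefs)
        have ux: "0 < u x" using pos x by simp
        define e where "e = x ^ n * (a0 x * f (u x)) / r ^ n"
        have "DERIV (\<lambda>s. energy (q s) - c * F (u s)) x :>
            h_inv \<phi> (q x) * e - c * (f (u x) * h_inv \<phi> (source u x))"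
          unfolding e_def using x q_pos[OF x(1,2)] ux
          by (intro DERIV_diff DERIV_cmult DERIV_chain2[of energy] DERIV_chain2[of F]
              energy_DERIV F_DERIV u_DERIV q_DERIV)
        moreover have "c * (f (u x) * h_inv \<phi> (source u x)) \<le> h_inv \<phi> (q x) * e"
        proof -
          have "c * f (u x) * h_inv \<phi> (source u x) \<le> e * h_inv \<phi> (q x)"
            unfolding e_def using q'_ge[OF x(4,2)] slope_le[OF x(1,2)] c f_pos[OF ux]
              h_inv_nonneg[OF src_nn, of x] x
            by (intro mult_mono) (auto intro: order.trans[rotated] simp: less_imp_le[OF mult_pos_pos])
          then show ?thesis by (simp add: mult_ac)
        qed
        ultimately show "\<exists>y. DERIV (\<lambda>s. energy (q s) - c * F (u s)) x :> y \<and> 0 \<le> y"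
          by (intro exI conjI) auto
      qed
      then show ?thesis using energy_nonneg[OF q_pos, of ra] d by (simp add: rdefs algebra_simps)
    qed
    \<comment> \<open>The energy estimate and doubling give
      \<Phi>(\<open>h_inv \<phi> (q s)\<close>) \<ge> \<mu> F(u). Applying \<open>Phi_inv\<close>
      extracts \<mu>, and passing from \<open>q\<close> to the true flux costs \<kappa>.\<close>
    have grow: "\<kappa> * \<mu> * w (u s) \<le> h_inv \<phi> (source u s)" if s: "rc \<le> s" "s \<le> r1" for s
    proof -
      have s': "ra \<le> s" "0 < s" using s d r by (auto simp: rdefs)
      have "2 * u ra \<le> u s" using uc mono[of rc s] s r d by (simp add: rdefs)
      then have F2: "2 * F (u ra) \<le> F (u s)" using F_double ua by simp
      have us: "0 < u s" using pos s' by simp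
      have "\<mu> * F (u s) \<le> c / (2 * (m - 1)) * F (u s)"
        using F_pos[OF us] by (intro mult_right_mono) (auto simp: \<mu>_def)
      also have "\<dots> \<le> Phi \<phi> (h_inv \<phi> (q s))"
      proof -
        have "c * (F (u s) / 2) \<le> c * (F (u s) - F (u ra))" using F2 c by (intro mult_left_mono) auto
        also have "\<dots> \<le> (m - 1) * Phi \<phi> (h_inv \<phi> (q s))"
          using energy[OF s'(1) s(2)] energy_le[OF q_pos[OF s'(1) s(2)]] by simp
        finally show ?thesis using m_gt by (simp add: field_simps)
      qed
      finally have "Phi_inv \<phi> (\<mu> * F (u s)) \<le> h_inv \<phi> (q s)"
        using \<mu> F_pos[OF us] h_inv_nonneg q_pos[OF s'(1) s(2)] by (intro Phi_inv_le) (auto simp: less_imp_le)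
      then have "\<mu> * w (u s) \<le> h_inv \<phi> (q s)"
        using Phi_inv_scale[OF \<mu>, of "F (u s)"] F_pos[OF us] by (simp add: w_def)
      then have "\<kappa> * (\<mu> * w (u s)) \<le> \<kappa> * h_inv \<phi> (q s)" using \<kappa> by simp
      also have "\<dots> \<le> h_inv \<phi> (source u s)" using slope_ge[OF s'(1) s(2)] .
      finally show ?thesis by (simp add: mult_ac)
    qed
    \<comment> \<open>A clock: along the solution J(u) has derivative u'/w(u) \<ge> \<kappa> \<mu>,
      so it gains at least \<kappa> \<mu> d over the last piece. By the choice of \<open>R1\<close>
      less than that is available.\<close>
    define J where "J x = integral {u 0..x} (\<lambda>t. 1 / w t)" for x
    have u01: "1 \<le> u 0" using u0 R1 by simp
    note iw = inverse_w_continuous[of "u 0"]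
    have "J (u rc) - \<kappa> * \<mu> * rc \<le> J (u r1) - \<kappa> * \<mu> * r1"
    proof (rule DERIV_nonneg_imp_nondecreasing[of rc r1])
      show "rc \<le> r1" using d by (simp add: rdefs)
      fix s assume s: "rc \<le> s" "s \<le> r1"
      then have s0: "0 < s" using r d by (simp add: rdefs)
      have "u rc \<le> u s" using mono[of rc s] s r d by (simp add: rdefs)
      then have us: "u 0 < u s" using uc ua ua0 by linarith
      have ws: "0 < w (u s)" using w_pos us u01 by simp
      have "DERIV J (u s) :> 1 / w (u s)"
        unfolding J_def
        using has_real_derivative_atLeast_interior[OF integral_DERIV_atLeast[OF iw] us] us u01 by simp
      then have "DERIV (\<lambda>s. J (u s) - \<kappa> * \<mu> * s) s :> 1 / w (u s) * h_inv \<phi> (source u s) - \<kappa> * \<mu> * 1"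
        by (intro DERIV_diff DERIV_chain2[of J] u_DERIV s0 DERIV_cmult DERIV_ident)
      moreover have "\<kappa> * \<mu> \<le> 1 / w (u s) * h_inv \<phi> (source u s)"
        using grow[OF s] ws by (simp add: field_simps)
      ultimately show "\<exists>y. DERIV (\<lambda>s. J (u s) - \<kappa> * \<mu> * s) s :> y \<and> 0 \<le> y"
        by (intro exI conjI) auto
    qed
    moreover have "J (u rc) + integral {u rc..u r1} (\<lambda>t. 1 / w t) = J (u r1)"
      unfolding J_def using mono[of rc r1] mono[of 0 rc] r d u01
      by (intro Henstock_Kurzweil_Integration.integral_combine continuous_on_atLeast_integrable[OF iw])
         (auto simp: rdefs)
    moreover have "integral {u rc..u r1} (\<lambda>t. 1 / w t) < \<kappa> * \<mu> * d"
      using mono[of rc r1] mono[of 0 rc] r d u0 by (intro R1(2)) (auto simp: rdefs)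
    moreover have "\<kappa> * \<mu> * r1 - \<kappa> * \<mu> * rc = \<kappa> * \<mu> * d" by (simp add: rdefs algebra_simps)
    ultimately show False by linarith
  qed
  then show ?thesis using that by blast
qed

end

section \<open>Smooth radial test functions\<close>

lemma linear_eq_inner:
  fixes f :: "'a::euclidean_space \<Rightarrow> real"
  assumes "linear f"
  shows "f v = v \<bullet> (\<Sum>b\<in>Basis. f b *\<^sub>R b)"
proof -
  have "f v = f (\<Sum>b\<in>Basis. (v \<bullet> b) *\<^sub>R b)" by (simp add: euclidean_representation)
  also have "\<dots> = (\<Sum>b\<in>Basis. (v \<bullet> b) * f b)"
    using assms by (simp add: linear_sum linear_cmul)
  finally show ?thesis by (simp add: inner_sum_right mult.commute)
qed

text \<open>Justifies the definite description in \<open>grad\<close>: the derivative is unique, and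
  a vector is determined by its inner products.\<close>

lemma grad_eqI:
  assumes "(u has_derivative (\<lambda>v. v \<bullet> D)) (at x)"
  shows "grad u x = D"
  unfolding grad_def gderiv_def
proof (rule the_equality)
  show "(u has_derivative (\<lambda>v. v \<bullet> D)) (at x)" by (rule assms)
next
  fix D' assume "(u has_derivative (\<lambda>v. v \<bullet> D')) (at x)"
  then have "(\<lambda>v. v \<bullet> D') = (\<lambda>v. v \<bullet> D)" using assms has_derivative_unique by blast
  then have "b \<bullet> D' = b \<bullet> D" for b by metis
  then show "D' = D" using vector_eq_ldot by blast
qed

lemma grad_works:
  assumes "u differentiable (at x)"
  shows "(u has_derivative (\<lambda>v. v \<bullet> grad u x)) (at x)"
proof -
  have d: "(u has_derivative frechet_derivative u (at x)) (at x)"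
    using assms frechet_derivative_works by blast
  define D where "D = (\<Sum>b\<in>Basis. frechet_derivative u (at x) b *\<^sub>R b)"
  have "frechet_derivative u (at x) = (\<lambda>v. v \<bullet> D)"
    unfolding D_def by (rule ext) (rule linear_eq_inner[OF has_derivative_linear[OF d]])
  then have "(u has_derivative (\<lambda>v. v \<bullet> D)) (at x)" using d by simp
  then show ?thesis using grad_eqI by metis
qed

lemma frechet_derivative_eq_grad:
  "u differentiable (at x) \<Longrightarrow> frechet_derivative u (at x) v = v \<bullet> grad u x"
  using grad_works frechet_derivative_at by metis

section \<open>Closure properties of the classes Ck\<close>

lemma Ck_SucI:
  assumes "\<And>x. (f has_derivative f' x) (at x)" "\<And>b. b \<in> Basis \<Longrightarrow> Ck k (\<lambda>x. f' x b)"
  shows "Ck (Suc k) f"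
proof -
  have "frechet_derivative f (at x) = f' x" for x using assms(1) frechet_derivative_at by metis
  then show ?thesis using assms by (auto simp: differentiable_def)
qed

lemma Ck_1_iff:
  "Ck 1 u \<longleftrightarrow> (\<forall>x. u differentiable (at x)) \<and> continuous_on UNIV (grad u)"
proof -
  have "(\<forall>b\<in>Basis. continuous_on UNIV (\<lambda>x. frechet_derivative u (at x) b)) \<longleftrightarrow> continuous_on UNIV (grad u)"
    if "\<forall>x. u differentiable (at x)"
    using that frechet_derivative_eq_grad[of u]
    by (subst continuous_on_componentwise) (simp add: inner_commute)
  then show ?thesis by auto
qed

lemma Ck_SucD: "Ck (Suc k) f \<Longrightarrow> Ck k f"
proof (induction k arbitrary: f)
  case 0
  then show ?case
    by (auto intro!: continuous_at_imp_continuous_on differentiable_imp_continuous_within)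
qed auto

lemma Ck_const [simp]: "Ck k (\<lambda>x. c)"
proof (induction k arbitrary: c)
  case (Suc k)
  then show ?case by (intro Ck_SucI[where f'="\<lambda>x v. 0"]) auto
qed simp

lemma Ck_inner: "Ck k (\<lambda>x. x \<bullet> b)"
proof (cases k)
  case (Suc j)
  show ?thesis unfolding Suc
    by (rule Ck_SucI[where f'="\<lambda>x v. v \<bullet> b"]) (auto intro!: derivative_eq_intros)
qed (auto intro!: continuous_intros)

lemma Ck_add: "Ck k f \<Longrightarrow> Ck k g \<Longrightarrow> Ck k (\<lambda>x. f x + g x)"
proof (induction k arbitrary: f g)
  case (Suc k)
  show ?case
  proof (rule Ck_SucI)
    show "((\<lambda>x. f x + g x) has_derivative (\<lambda>v. frechet_derivative f (at x) v + frechet_derivative g (at x) v)) (at x)" for x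
      using Suc.prems by (auto intro!: derivative_eq_intros simp: frechet_derivative_works)
  qed (use Suc in auto)
qed (auto intro!: continuous_intros)

lemma Ck_mult: "Ck k f \<Longrightarrow> Ck k g \<Longrightarrow> Ck k (\<lambda>x. f x * g x)"
proof (induction k arbitrary: f g)
  case (Suc k)
  show ?case
  proof (rule Ck_SucI)
    show "((\<lambda>x. f x * g x) has_derivative (\<lambda>v. f x * frechet_derivative g (at x) v + frechet_derivative f (at x) v * g x)) (at x)" for x
      using Suc.prems by (intro has_derivative_mult) (auto simp: frechet_derivative_works)
    show "Ck k (\<lambda>x. f x * frechet_derivative g (at x) b + frechet_derivative f (at x) b * g x)" if "b \<in> Basis" for b
      using Suc that Ck_SucD[of k f] Ck_SucD[of k g] by (intro Ck_add Suc.IH) auto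
  qed
qed (auto intro!: continuous_intros)

text \<open>The induction must vary \<theta>: a partial derivative of the composition is a partial
  derivative of \<open>g\<close> times \<theta>'(g x), where \<theta>' is
  \<open>frechet_derivative\<close> of \<theta> in the direction 1.\<close>

lemma Ck_compose:
  fixes \<theta> :: "real \<Rightarrow> real"
  shows "Ck k \<theta> \<Longrightarrow> Ck k g \<Longrightarrow> Ck k (\<lambda>x. \<theta> (g x))"
proof (induction k arbitrary: \<theta> g)
  case 0
  then show ?case by (auto intro: continuous_on_compose2)
next
  case (Suc k)
  have lin: "frechet_derivative \<theta> (at s) v = v * frechet_derivative \<theta> (at s) 1" for s v
  proof -
    have "linear (frechet_derivative \<theta> (at s))"
      using Suc.prems(1) by (auto simp: frechet_derivative_works intro: has_derivative_linear)
    then show ?thesis using linear_cmul[of "frechet_derivative \<theta> (at s)" v 1] by simp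
  qed
  show ?case
  proof (rule Ck_SucI)
    show "((\<lambda>x. \<theta> (g x)) has_derivative
        (\<lambda>v. frechet_derivative \<theta> (at (g x)) (frechet_derivative g (at x) v))) (at x)" for x
    proof -
      have "(g has_derivative frechet_derivative g (at x)) (at x)"
        using Suc.prems by (simp add: frechet_derivative_works)
      moreover have "(\<theta> has_derivative frechet_derivative \<theta> (at (g x))) (at (g x))"
        using Suc.prems by (simp add: frechet_derivative_works)
      ultimately show ?thesis by (rule has_derivative_compose)
    qed
    show "Ck k (\<lambda>x. frechet_derivative \<theta> (at (g x)) (frechet_derivative g (at x) b))" if "b \<in> Basis" for b
    proof -
      have "Ck k (\<lambda>x. frechet_derivative g (at x) b * frechet_derivative \<theta> (at (g x)) 1)"
        using Suc.prems that Ck_SucD[of k g] by (intro Ck_mult[OF _ Suc.IH]) auto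
      then show ?thesis by (subst lin)
    qed
  qed
qed

lemma Ck_real_SucI:
  fixes f :: "real \<Rightarrow> real"
  assumes "\<And>x. DERIV f x :> f' x" "Ck k f'"
  shows "Ck (Suc k) f"
  by (rule Ck_SucI[where f'="\<lambda>x v. f' x * v"]) (use assms in \<open>auto simp: has_field_derivative_def\<close>)

lemma Ck_real_affine: "Ck k (\<lambda>x::real. a * x + b)"
  using Ck_add[OF Ck_mult[OF Ck_const Ck_inner[of k "1::real"]] Ck_const, of a b]
  by (simp add: inner_real_def)

lemma Ck_inner_self: "Ck k (\<lambda>x::'a::euclidean_space. x \<bullet> x)"
proof (cases k)
  case (Suc j)
  show ?thesis unfolding Suc
  proof (rule Ck_SucI[where f'="\<lambda>x v. 2 * (x \<bullet> v)"])
    show "((\<lambda>x. x \<bullet> x) has_derivative (\<lambda>v. 2 * (x \<bullet> v))) (at x)" for x :: 'a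
      by (auto intro!: derivative_eq_intros simp: inner_commute)
    show "Ck j (\<lambda>x::'a. 2 * (x \<bullet> b))" for b by (intro Ck_mult Ck_inner Ck_const)
  qed
qed (auto intro!: continuous_intros)

text \<open>The polynomial parameter makes the family closed under differentiation, so that
  smoothness of exp(-1/t) across 0 is an induction over all \<open>p\<close> at once.\<close>

definition flat :: "real poly \<Rightarrow> real \<Rightarrow> real" where
  "flat p t = (if 0 < t then poly p (1 / t) * exp (- (1 / t)) else 0)"

lemma poly_exp_tendsto_0: "((\<lambda>x::real. poly p x * exp (- x)) \<longlongrightarrow> 0) at_top"
proof -
  have "((\<lambda>x. \<Sum>i\<le>degree p. coeff p i * (x ^ i / exp x)) \<longlongrightarrow> (\<Sum>i\<le>degree p. coeff p i * 0)) at_top"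
    by (intro tendsto_sum tendsto_mult tendsto_const tendsto_power_div_exp_0)
  then show ?thesis
    by (simp add: poly_altdef exp_minus divide_inverse sum_distrib_left mult_ac)
qed

lemma flat_DERIV: "DERIV (flat p) t :> flat ([:0, 0, 1:] * (p - pderiv p)) t"
proof -
  consider "0 < t" | "t < 0" | "t = 0" by linarith
  then show ?thesis
  proof cases
    case 1
    have "DERIV (\<lambda>t. poly p (1 / t) * exp (- (1 / t))) t :>
        poly p (1 / t) * (exp (- (1 / t)) * (1 / t\<^sup>2)) + poly (pderiv p) (1 / t) * (- (1 / t\<^sup>2)) * exp (- (1 / t))"
      using 1 by (intro DERIV_mult' DERIV_chain2[OF poly_DERIV])
        (auto intro!: derivative_eq_intros simp: power2_eq_square field_simps)
    also have "poly p (1 / t) * (exp (- (1 / t)) * (1 / t\<^sup>2)) + poly (pderiv p) (1 / t) * (- (1 / t\<^sup>2)) * exp (- (1 / t))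
        = flat ([:0, 0, 1:] * (p - pderiv p)) t"
      using 1 by (simp add: flat_def field_simps power2_eq_square)
    finally show ?thesis
      by (rule has_field_derivative_transform_within_open[of _ _ _ "{0<..}"]) (use 1 in \<open>auto simp: flat_def\<close>)
  next
    case 2
    have "DERIV (\<lambda>t. 0) t :> flat ([:0, 0, 1:] * (p - pderiv p)) t" using 2 by (simp add: flat_def)
    then show ?thesis
      by (rule has_field_derivative_transform_within_open[of _ _ _ "{..<0}"]) (use 2 in \<open>auto simp: flat_def\<close>)
  next
    case 3
    \<comment> \<open>From the right, x = 1/h turns the difference quotient into x p(x) exp(-x),
      which is of the same type with the polynomial \<open>pCons 0 p\<close>.\<close>
    have "((\<lambda>h. flat p h / h) \<longlongrightarrow> 0) (at 0)"
    proof (rule filterlim_split_at_real)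
      have "\<forall>\<^sub>F h in at_left 0. flat p h / h = 0"
        by (auto simp: eventually_at flat_def intro!: exI[of _ 1])
      then show "((\<lambda>h. flat p h / h) \<longlongrightarrow> 0) (at_left 0)" by (rule tendsto_eventually)
      have "((\<lambda>h. poly (pCons 0 p) (inverse h) * exp (- inverse h)) \<longlongrightarrow> 0) (at_right 0)"
        by (rule filterlim_compose[OF poly_exp_tendsto_0 filterlim_inverse_at_top_right])
      moreover have "\<forall>\<^sub>F h in at_right 0. poly (pCons 0 p) (inverse h) * exp (- inverse h) = flat p h / h"
        by (auto simp: eventually_at flat_def divide_inverse mult_ac intro!: exI[of _ 1])
      ultimately show "((\<lambda>h. flat p h / h) \<longlongrightarrow> 0) (at_right 0)" by (rule Lim_transform_eventually)
    qed
    then show ?thesis using 3 by (simp add: DERIV_def flat_def[of p 0] flat_def[of _ 0])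
  qed
qed

lemma Ck_flat: "Ck k (flat p)"
proof (induction k arbitrary: p)
  case 0
  show ?case using DERIV_continuous_on[OF has_field_derivative_at_within[OF flat_DERIV]] by simp
next
  case (Suc k)
  show ?case by (rule Ck_real_SucI[OF flat_DERIV Suc])
qed

definition bump :: "real \<Rightarrow> real \<Rightarrow> real \<Rightarrow> real" where
  "bump \<alpha> \<beta> s = flat 1 (s - \<alpha>) * flat 1 (\<beta> - s)"

lemma Ck_bump: "Ck k (bump \<alpha> \<beta>)"
proof -
  have "Ck k (\<lambda>s. flat 1 (1 * s + (- \<alpha>)) * flat 1 ((-1) * s + \<beta>))"
    by (intro Ck_mult Ck_compose[OF Ck_flat] Ck_real_affine)
  moreover have "(\<lambda>s. flat 1 (1 * s + (- \<alpha>)) * flat 1 ((-1) * s + \<beta>)) = bump \<alpha> \<beta>"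
    by (rule ext) (simp add: bump_def)
  ultimately show ?thesis by simp
qed

lemma bump_nonneg: "0 \<le> bump \<alpha> \<beta> s"
  and bump_pos_iff: "0 < bump \<alpha> \<beta> s \<longleftrightarrow> \<alpha> < s \<and> s < \<beta>"
  and bump_eq_0: "\<not> (\<alpha> < s \<and> s < \<beta>) \<Longrightarrow> bump \<alpha> \<beta> s = 0"
  by (auto simp: bump_def flat_def)

text \<open>Normalised to vanish at the right end, not the left: \<theta>(|x|^2) then has bounded
  support, while the non-zero constant value of \<theta> to the left of \<alpha> does no
  harm.\<close>

lemma bump_antiderivative:
  obtains \<theta> where "\<And>s. DERIV \<theta> s :> bump \<alpha> \<beta> s" "\<And>s. \<beta> \<le> s \<Longrightarrow> \<theta> s = 0"
proof -
  have cont: "continuous_on UNIV (bump \<alpha> \<beta>)" using Ck_bump[of 0] by simp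
  define F where "F s = integral {\<alpha>-1..s} (bump \<alpha> \<beta>)" for s
  have F: "DERIV F s :> bump \<alpha> \<beta> s" for s
  proof (cases "\<alpha> - 1 < s")
    case True
    then show ?thesis unfolding F_def
      by (intro has_real_derivative_atLeast_interior[OF integral_DERIV_atLeast])
         (auto intro: continuous_on_subset[OF cont])
  next
    case False
    have 0: "F t = 0" if "t < \<alpha>" for t
    proof -
      have "F t = integral {\<alpha>-1..t} (\<lambda>_. 0)"
        unfolding F_def using that by (intro integral_cong bump_eq_0) auto
      then show ?thesis by simp
    qed
    have "DERIV (\<lambda>_. 0) s :> bump \<alpha> \<beta> s" using False bump_eq_0[of \<alpha> s \<beta>] by simp
    then show ?thesis
      by (rule has_field_derivative_transform_within_open[of _ _ _ "{..<\<alpha>}"]) (use False 0 in auto)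
  qed
  have "F s - F \<beta> = 0" if "\<beta> \<le> s" for s
  proof (cases "\<beta> = s")
    case False
    then have "\<beta> < s" using that by simp
    then have "F s = F \<beta>"
    proof (rule DERIV_isconst_end)
      show "continuous_on {\<beta>..s} F" by (rule DERIV_continuous_on[OF has_field_derivative_at_within[OF F]])
      show "DERIV F t :> 0" if "\<beta> < t" for t using F[of t] bump_eq_0[of \<alpha> t \<beta>] that by simp
    qed
    then show ?thesis by simp
  qed simp
  moreover have "DERIV (\<lambda>s. F s - F \<beta>) s :> bump \<alpha> \<beta> s" for s
    using DERIV_diff[OF F DERIV_const[of "F \<beta>"]] by simp
  ultimately show ?thesis using that by blast
qed

text \<open>It is the gradient that must be a prescribed non-negative multiple of x, so the test
  function is an antiderivative of a bump. Composing with |x|^2 instead of |x| avoids the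
  singularity of the norm at the origin.\<close>

lemma radial_test_function:
  obtains \<psi> :: "'a::euclidean_space \<Rightarrow> real" where "test_function \<psi>"
    "\<And>x. grad \<psi> x = (2 * bump \<alpha> \<beta> (x \<bullet> x)) *\<^sub>R x"
proof -
  obtain \<theta> where \<theta>: "\<And>s. DERIV \<theta> s :> bump \<alpha> \<beta> s" "\<And>s. \<beta> \<le> s \<Longrightarrow> \<theta> s = 0"
    using bump_antiderivative by blast
  define \<psi> where "\<psi> x = \<theta> (x \<bullet> x)" for x :: 'a
  have "Ck k \<psi>" for k
  proof -
    have "Ck k \<theta>" using Ck_real_SucI[OF \<theta>(1) Ck_bump] by (rule Ck_SucD)
    then show ?thesis unfolding \<psi>_def by (rule Ck_compose[OF _ Ck_inner_self])
  qed
  moreover have "bounded {x. \<psi> x \<noteq> 0}"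
  proof (rule boundedI)
    fix x assume "x \<in> {x. \<psi> x \<noteq> 0}"
    then have "x \<bullet> x \<le> \<beta>" using \<theta>(2)[of "x \<bullet> x"] by (cases "\<beta> \<le> x \<bullet> x") (auto simp: \<psi>_def)
    then show "norm x \<le> sqrt \<beta>" by (simp add: norm_eq_sqrt_inner)
  qed
  moreover have "grad \<psi> x = (2 * bump \<alpha> \<beta> (x \<bullet> x)) *\<^sub>R x" for x
  proof (rule grad_eqI)
    have "((\<lambda>x. \<theta> (x \<bullet> x)) has_derivative (\<lambda>v. bump \<alpha> \<beta> (x \<bullet> x) * (x \<bullet> v + v \<bullet> x))) (at x)"
    proof (rule has_derivative_compose[of "\<lambda>x. x \<bullet> x" "\<lambda>v. x \<bullet> v + v \<bullet> x" x UNIV \<theta>])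
      show "((\<lambda>x. x \<bullet> x) has_derivative (\<lambda>v. x \<bullet> v + v \<bullet> x)) (at x)"
        by (auto intro!: derivative_eq_intros)
    qed (use \<theta>(1) in \<open>simp add: has_field_derivative_def\<close>)
    then show "(\<psi> has_derivative (\<lambda>v. v \<bullet> (2 * bump \<alpha> \<beta> (x \<bullet> x)) *\<^sub>R x)) (at x)"
      unfolding \<psi>_def by (simp add: inner_commute algebra_simps)
  qed
  ultimately show ?thesis using that[of \<psi>] by (auto simp: test_function_def)
qed

lemma test_function_support:
  assumes "test_function \<psi>"
  obtains R where "\<And>x. R < norm x \<Longrightarrow> \<psi> x = 0"
proof -
  have "bounded {x. \<psi> x \<noteq> 0}"
    using assms bounded_subset[OF compact_imp_bounded closure_subset] by (simp add: test_function_def)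
  then obtain R where "\<forall>x\<in>{x. \<psi> x \<noteq> 0}. norm x \<le> R" using bounded_iff by blast
  then show ?thesis using that[of R] by force
qed

section \<open>Divergence of radial fields\<close>

lemma integrable_compact_support:
  fixes f :: "'a::euclidean_space \<Rightarrow> real"
  assumes "continuous_on UNIV f" "\<And>x. R < norm x \<Longrightarrow> f x = 0"
  shows "integrable lborel f"
proof -
  have "integrable lborel (\<lambda>x. indicator (cball 0 R) x *\<^sub>R f x)"
    by (intro borel_integrable_compact continuous_on_subset[OF assms(1)]) auto
  moreover have "(\<lambda>x. indicator (cball 0 R) x *\<^sub>R f x) = f"
    using assms(2) by (auto simp: fun_eq_iff indicator_def)
  ultimately show ?thesis by simp
qed

text \<open>Difference quotients have integral \<open>0\<close> by translation invariance; pass to the limit by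
  dominated convergence.\<close>

lemma integral_directional_derivative:
  fixes w :: "'a::euclidean_space \<Rightarrow> real"
  assumes der: "\<And>x. (w has_derivative w' x) (at x)"
    and bound: "\<And>x. \<bar>w' x c\<bar> \<le> B" and supp: "\<And>x. R < norm x \<Longrightarrow> w x = 0"
  shows integrable_directional_derivative: "integrable lborel (\<lambda>x. w' x c)"
    and integral_directional_derivative_eq_0: "integral\<^sup>L lborel (\<lambda>x. w' x c) = 0"
proof -
  have w_cont: "continuous_on UNIV w"
    using has_derivative_continuous[OF der] by (intro continuous_at_imp_continuous_on) auto
  have w_int: "integrable lborel w" using w_cont supp by (rule integrable_compact_support)
  have w_meas [measurable]: "w \<in> borel_measurable borel"
    using w_cont by (rule borel_measurable_continuous_onI)
  have line: "DERIV (\<lambda>s. w (x + s *\<^sub>R c)) s :> w' (x + s *\<^sub>R c) c" for x s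
  proof -
    have "((\<lambda>s. x + s *\<^sub>R c) has_derivative (\<lambda>s. s *\<^sub>R c)) (at s)"
      by (auto intro!: derivative_eq_intros)
    from has_derivative_compose[OF this der]
    have "((\<lambda>s. w (x + s *\<^sub>R c)) has_derivative (\<lambda>r. w' (x + s *\<^sub>R c) (r *\<^sub>R c))) (at s)" .
    then show ?thesis
      unfolding has_field_derivative_def
      using linear_cmul[OF has_derivative_linear[OF der]] by (simp add: mult_commute_abs)
  qed
  define q where "q k x = (w (x + inverse (real (Suc k)) *\<^sub>R c) - w x) * real (Suc k)" for k x
  have q_lim: "(\<lambda>k. q k x) \<longlonglongrightarrow> w' x c" for x
  proof -
    have "((\<lambda>s. (w (x + s *\<^sub>R c) - w x) / s) \<longlongrightarrow> w' x c) (at 0)"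
      using line[of x 0] by (simp add: DERIV_def)
    moreover have "filterlim (\<lambda>k. inverse (real (Suc k))) (at 0) sequentially"
      unfolding filterlim_at using LIMSEQ_inverse_real_of_nat by simp
    ultimately have "(\<lambda>k. (w (x + inverse (real (Suc k)) *\<^sub>R c) - w x) / inverse (real (Suc k))) \<longlonglongrightarrow> w' x c"
      by (rule filterlim_compose)
    then show ?thesis by (simp add: q_def divide_inverse del: of_nat_Suc)
  qed
  \<comment> \<open>The mean value theorem bounds the quotients by B. They are supported in the ball
    enlarged by \<open>norm c\<close>, because the shifts have length at most that.\<close>
  have q_bound: "\<bar>q k x\<bar> \<le> B * indicator (cball 0 (R + norm c)) x" for k x
  proof -
    define t where "t = inverse (real (Suc k))"
    have t: "0 < t" "t \<le> 1" by (auto simp: t_def inverse_le_1_iff)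
    show ?thesis
    proof (cases "norm x \<le> R + norm c")
      case True
      obtain z where z: "w (x + t *\<^sub>R c) - w (x + 0 *\<^sub>R c) = (t - 0) * w' (x + z *\<^sub>R c) c"
        using MVT2[OF t(1), of "\<lambda>s. w (x + s *\<^sub>R c)" "\<lambda>s. w' (x + s *\<^sub>R c) c"] line by metis
      then have "q k x = w' (x + z *\<^sub>R c) c"
        by (simp add: q_def t_def[symmetric] del: of_nat_Suc) (simp add: t_def del: of_nat_Suc)
      then show ?thesis using bound True by simp
    next
      case False
      have "norm x \<le> norm (x + t *\<^sub>R c) + norm (t *\<^sub>R c)" by (metis add_diff_cancel norm_triangle_ineq4)
      moreover have "norm (t *\<^sub>R c) \<le> norm c" using t by (simp add: mult_left_le_one_le)
      ultimately have "R < norm (x + t *\<^sub>R c)" "R < norm x" using False norm_ge_zero[of c] by linarith+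
      then show ?thesis using supp False by (simp add: q_def t_def[symmetric] del: of_nat_Suc)
    qed
  qed
  have q_int: "integral\<^sup>L lborel (q k) = 0" for k
  proof -
    have shift: "integral\<^sup>L lborel (\<lambda>x. w (x + d)) = integral\<^sup>L lborel w" for d
      using integral_distr[of "(+) d" lborel borel w] lborel_distr_plus[of d] w_meas
      by (simp add: add.commute)
    have shift_int: "integrable lborel (\<lambda>x. w (x + d))" for d
      using integrable_distr_eq[of "(+) d" lborel borel w] lborel_distr_plus[of d] w_meas w_int
      by (simp add: add.commute)
    show ?thesis unfolding q_def using shift shift_int w_int by (simp del: of_nat_Suc)
  qed
  have dom: "integrable lborel (\<lambda>x::'a. B * indicator (cball 0 (R + norm c)) x)"
    using emeasure_bounded_finite[OF bounded_cball, of "0::'a" "R + norm c"]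
    by (intro integrable_mult_right integrable_real_indicator) auto
  have q_meas: "q k \<in> borel_measurable lborel" for k unfolding q_def by measurable
  \<comment> \<open>The derivative is not assumed continuous; it is measurable as a limit of
    difference quotients.\<close>
  have m: "(\<lambda>x. w' x c) \<in> borel_measurable lborel"
    by (rule borel_measurable_LIMSEQ_real[OF q_lim q_meas])
  note hyps = m q_meas dom AE_I2[OF q_lim] AE_I2[OF q_bound[folded real_norm_def]]
  show "integrable lborel (\<lambda>x. w' x c)"
    by (rule integrable_dominated_convergence[OF hyps])
  have "(\<lambda>k. integral\<^sup>L lborel (q k)) \<longlonglongrightarrow> integral\<^sup>L lborel (\<lambda>x. w' x c)"
    by (rule integral_dominated_convergence[OF hyps])
  then show "integral\<^sup>L lborel (\<lambda>x. w' x c) = 0"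
    using q_int LIMSEQ_unique[OF _ tendsto_const] by simp
qed

section \<open>Radial functions and fields at the origin\<close>

lemma continuous_on_norm_compose:
  fixes g :: "real \<Rightarrow> real"
  assumes "continuous_on {0..} g"
  shows "continuous_on UNIV (\<lambda>x::'a::real_normed_vector. g (norm x))"
  by (rule continuous_on_compose2[OF assms]) (auto intro: continuous_intros)

lemma filterlim_norm_at_0: "filterlim (norm :: 'a::real_normed_vector \<Rightarrow> real) (at 0 within {0..}) (at 0)"
  unfolding filterlim_at by (auto simp: eventually_at intro!: tendsto_eq_intros exI[of _ 1])

lemma continuous_on_radial_field:
  fixes g :: "real \<Rightarrow> real"
  assumes g: "continuous_on {0..} g" "g 0 = 0"
  shows "continuous_on UNIV (\<lambda>x::'a::real_normed_vector. (g (norm x) / norm x) *\<^sub>R x)"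
proof (intro continuous_at_imp_continuous_on ballI)
  fix x :: 'a
  have gc: "isCont (\<lambda>x::'a. g (norm x)) y" for y
    using continuous_on_norm_compose[OF g(1), where 'a='a] by (simp add: continuous_on_eq_continuous_at)
  show "isCont (\<lambda>x. (g (norm x) / norm x) *\<^sub>R x) x"
  proof (cases "x = 0")
    case True
    have "((\<lambda>x::'a. \<bar>g (norm x)\<bar>) \<longlongrightarrow> 0) (at 0)"
      using gc[of 0] g(2) by (auto simp: isCont_def intro: tendsto_rabs_zero)
    then have "((\<lambda>x::'a. (g (norm x) / norm x) *\<^sub>R x) \<longlongrightarrow> 0) (at 0)"
      by (rule Lim_null_comparison[rotated]) (auto simp: eventually_at intro!: exI[of _ 1])
    then show ?thesis using True by (simp add: isCont_def)
  next
    case False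
    then show ?thesis using gc by (intro continuous_intros) auto
  qed
qed

text \<open>The case x = 0 is the reason for the condition d = 0: then u(|v|) - u(0) = o(|v|), so
  the gradient at the origin is 0.\<close>

lemma has_derivative_radial:
  fixes u :: "real \<Rightarrow> real" and x :: "'a::real_inner"
  assumes u: "(u has_real_derivative d) (at (norm x) within {0..})" and 0: "x = 0 \<Longrightarrow> d = 0"
  shows "((\<lambda>x. u (norm x)) has_derivative (\<lambda>v. v \<bullet> ((d / norm x) *\<^sub>R x))) (at x)"
proof (cases "x = 0")
  case True
  then have "((\<lambda>r. (u r - u 0) / r) \<longlongrightarrow> 0) (at 0 within {0..})"
    using u 0 by (simp add: has_field_derivative_iff)
  then have lim: "((\<lambda>v::'a. (u (norm v) - u 0) / norm v) \<longlongrightarrow> 0) (at 0)"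
    by (rule filterlim_compose[OF _ filterlim_norm_at_0])
  have "((\<lambda>x. u (norm x)) has_derivative (\<lambda>v. 0)) (at (0::'a))"
    unfolding has_derivative_at using tendsto_rabs_zero[OF lim] by (simp add: bounded_linear_zero)
  then show ?thesis using True by simp
next
  case False
  have "DERIV u (norm x) :> d"
    using u False by (intro has_real_derivative_atLeast_interior) auto
  then have "(u has_derivative (\<lambda>v. d * v)) (at (norm x))" by (simp add: has_field_derivative_def)
  from has_derivative_compose[OF has_derivative_norm[OF False] this]
  have "((\<lambda>x. u (norm x)) has_derivative (\<lambda>v. d * (v \<bullet> sgn x))) (at x)" .
  moreover have "(\<lambda>v. d * (v \<bullet> sgn x)) = (\<lambda>v. v \<bullet> ((d / norm x) *\<^sub>R x))"
    by (simp add: sgn_div_norm divide_inverse mult_ac)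
  ultimately show ?thesis by simp
qed

text \<open>A linear factor vanishing at 0 makes mere continuity of the other factor enough. Applied
  to the coordinates of g(|x|) x, where g(|x|) itself may fail to be differentiable at the
  origin.\<close>

lemma has_derivative_vanishing_mult:
  fixes x :: "'a::real_normed_vector" and f g :: "'a \<Rightarrow> real"
  assumes "bounded_linear g" "(f \<longlongrightarrow> f 0) (at 0)"
  shows "((\<lambda>x. f x * g x) has_derivative (\<lambda>v. f 0 * g v)) (at 0)"
proof -
  interpret bounded_linear g by fact
  obtain K where K: "\<And>v. norm (g v) \<le> norm v * K" using bounded by blast
  have "((\<lambda>v. (f v - f 0) * K) \<longlongrightarrow> (f 0 - f 0) * K) (at 0)" using assms(2) by (intro tendsto_intros)
  then have "((\<lambda>v. norm ((f v - f 0) * K)) \<longlongrightarrow> 0) (at 0)" by (auto intro: tendsto_rabs_zero)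
  moreover have "norm (norm (f v * g v - f 0 * g v) / norm v) \<le> norm ((f v - f 0) * K)" if "v \<noteq> 0" for v
  proof -
    have "norm (f v * g v - f 0 * g v) = \<bar>f v - f 0\<bar> * \<bar>g v\<bar>" by (simp add: abs_mult left_diff_distrib[symmetric])
    also have "\<dots> \<le> \<bar>f v - f 0\<bar> * (norm v * \<bar>K\<bar>)"
      using K[of v] mult_left_mono[OF abs_ge_self[of K] norm_ge_zero[of v]]
      by (intro mult_left_mono) auto
    also have "\<dots> = norm ((f v - f 0) * K) * norm v" by (simp add: abs_mult mult_ac)
    finally show ?thesis using that by (simp add: pos_divide_le_eq)
  qed
  then have "\<forall>\<^sub>F v in at 0. norm (norm (f v * g v - f 0 * g v) / norm v) \<le> norm ((f v - f 0) * K)"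
    by (auto simp: eventually_at intro!: exI[of _ 1])
  ultimately have "((\<lambda>v. norm (f v * g v - f 0 * g v) / norm v) \<longlongrightarrow> 0) (at 0)"
    by (rule Lim_null_comparison[rotated])
  then show ?thesis
    unfolding has_derivative_at using assms(1) by (simp add: zero bounded_linear_const_mult)
qed

lemma grad_eq_0_outside:
  fixes \<psi> :: "'a::euclidean_space \<Rightarrow> real"
  assumes "\<And>x. R < norm x \<Longrightarrow> \<psi> x = 0" "R < norm x"
  shows "grad \<psi> x = 0"
proof (rule grad_eqI)
  have "open {y::'a. R < norm y}" by (intro open_Collect_less continuous_intros)
  moreover have "((\<lambda>_. 0) has_derivative (\<lambda>v. v \<bullet> 0)) (at x)" by simp
  ultimately show "(\<psi> has_derivative (\<lambda>v. v \<bullet> 0)) (at x)"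
    using has_derivative_transform_within_open[of "\<lambda>_. 0" "\<lambda>v. v \<bullet> 0" x UNIV "{y. R < norm y}" \<psi>] assms
    by auto
qed

text \<open>The field is \<open>x \<mapsto> g(|x|) x\<close> with \<open>g(r) = r\<^sup>-\<^sup>N \<integral>\<^sub>0\<^sup>r t\<^sup>N\<^sup>-\<^sup>1 b(t) dt\<close>; it extends differentiably to the origin
  by \<open>g(0) = b(0)/N\<close>, and its divergence is \<open>N g + r g' = b\<close>.\<close>

lemma radial_divergence:
  fixes \<psi> :: "'a::euclidean_space \<Rightarrow> real"
  assumes dim: "DIM('a) = Suc n"
    and b: "continuous_on {0..} b" "\<And>t. 0 \<le> t \<Longrightarrow> 0 \<le> b t"
    and \<psi>: "\<And>x. \<psi> differentiable (at x)" "continuous_on UNIV (grad \<psi>)"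
    and supp: "\<And>x. R < norm x \<Longrightarrow> \<psi> x = 0"
  shows "(LINT x|lborel. ((radial_mean n b (norm x) / norm x) *\<^sub>R x) \<bullet> grad \<psi> x)
    = - (LINT x|lborel. b (norm x) * \<psi> x)"
proof -
  define N where "N = real (Suc n)"
  have N: "1 \<le> N" by (simp add: N_def)
  define P where "P r = integral {0..r} (\<lambda>t. t ^ n * b t)" for r
  define g where "g r = (if r = 0 then b 0 / N else radial_mean n b r / r)" for r
  have g_pos: "g r = P r / r ^ Suc n" if "0 < r" for r
    using that by (simp add: g_def radial_mean_def P_def)
  have P_DERIV: "DERIV P r :> r ^ n * b r" if "0 < r" for r
    unfolding P_def using that
    by (intro has_real_derivative_atLeast_interior[OF integral_DERIV_atLeast] power_mult_continuous b) auto
  have g_DERIV: "DERIV g r :> (b r - N * g r) / r" if r: "0 < r" for r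
  proof -
    have "DERIV (\<lambda>r. P r / r ^ Suc n) r :>
        (r ^ n * b r * r ^ Suc n - P r * (real (Suc n) * r ^ n)) / (r ^ Suc n * r ^ Suc n)"
      using r DERIV_pow[of "Suc n" r] by (intro DERIV_divide P_DERIV) (auto simp del: power_Suc of_nat_Suc)
    also have "(r ^ n * b r * r ^ Suc n - P r * (real (Suc n) * r ^ n)) / (r ^ Suc n * r ^ Suc n)
        = (b r - N * g r) / r"
      using r by (simp add: g_pos N_def field_simps del: of_nat_Suc)
    finally show ?thesis
      by (rule has_field_derivative_transform_within_open[of _ _ _ "{0<..}"]) (use r g_pos in auto)
  qed
  have g_lim: "(g \<longlongrightarrow> g 0) (at 0 within {0..})"
  proof -
    have "((\<lambda>r. P r / r ^ Suc n) \<longlongrightarrow> b 0 / N) (at_right 0)"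
    proof (rule lhopital_right_0)
      have "continuous_on {0..} P"
        unfolding P_def by (rule has_real_derivative_imp_continuous_on_atLeast[OF integral_DERIV_atLeast[OF power_mult_continuous[OF b(1)]]])
      then have "(P \<longlongrightarrow> P 0) (at 0 within {0..})" unfolding continuous_on_def by (rule bspec) simp
      then show "(P \<longlongrightarrow> 0) (at_right 0)" by (simp add: at_within_Ici_at_right P_def)
      show "((\<lambda>r::real. r ^ Suc n) \<longlongrightarrow> 0) (at_right 0)" by (auto intro!: tendsto_eq_intros)
      show "\<forall>\<^sub>F r in at_right 0. r ^ Suc n \<noteq> (0::real)" by (auto simp: eventually_at intro!: exI[of _ 1])
      show "\<forall>\<^sub>F r in at_right 0. N * r ^ n \<noteq> 0"
        using eventually_at_right_less[of 0] by eventually_elim (use N in auto)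
      show "\<forall>\<^sub>F r in at_right 0. DERIV P r :> r ^ n * b r"
        using P_DERIV by (auto simp: eventually_at intro!: exI[of _ 1])
      show "\<forall>\<^sub>F r in at_right 0. DERIV (\<lambda>r. r ^ Suc n) r :> N * r ^ n"
        using DERIV_pow[of "Suc n"] by (intro always_eventually allI) (simp add: N_def)
      have "(b \<longlongrightarrow> b 0) (at 0 within {0..})" using b(1) unfolding continuous_on_def by (rule bspec) simp
      then have "((\<lambda>r. b r / N) \<longlongrightarrow> b 0 / N) (at_right 0)"
        using N by (intro tendsto_intros) (auto simp: at_within_Ici_at_right)
      then show "((\<lambda>r. r ^ n * b r / (N * r ^ n)) \<longlongrightarrow> b 0 / N) (at_right 0)"
        by (rule Lim_transform_eventually) (auto simp: eventually_at intro!: exI[of _ 1])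
    qed
    then have "(g \<longlongrightarrow> b 0 / N) (at_right 0)"
      by (rule Lim_transform_eventually) (auto simp: eventually_at g_pos intro!: exI[of _ 1])
    then show ?thesis by (simp add: at_within_Ici_at_right g_def)
  qed
  \<comment> \<open>This is g'(r)/r at r = |x|, the coefficient in the gradient of g(|x|); the value
    at 0 is a convenience.\<close>
  define A where "A x = (if x = 0 then 0 else (b (norm x) - N * g (norm x)) / (norm x)\<^sup>2)" for x :: 'a
  have V_der: "((\<lambda>x. g (norm x) * (x \<bullet> i)) has_derivative
      (\<lambda>v. g (norm x) * (v \<bullet> i) + A x * (v \<bullet> x) * (x \<bullet> i))) (at x)" for x i :: 'a
  proof (cases "x = 0")
    case True
    have "((\<lambda>x::'a. g (norm x)) \<longlongrightarrow> g 0) (at 0)"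
      by (rule filterlim_compose[OF g_lim filterlim_norm_at_0])
    then show ?thesis
      using has_derivative_vanishing_mult[of "\<lambda>v. v \<bullet> i" "\<lambda>x. g (norm x)"] True
      by (simp add: bounded_linear_inner_left)
  next
    case False
    have "((\<lambda>x. g (norm x)) has_derivative
        (\<lambda>v. v \<bullet> (((b (norm x) - N * g (norm x)) / norm x / norm x) *\<^sub>R x))) (at x)"
      using False by (intro has_derivative_radial has_field_derivative_at_within[OF g_DERIV]) auto
    then have "((\<lambda>x. g (norm x)) has_derivative (\<lambda>v. A x * (v \<bullet> x))) (at x)"
      using False by (simp add: A_def power2_eq_square)
    moreover have "((\<lambda>x. x \<bullet> i) has_derivative (\<lambda>v. v \<bullet> i)) (at x)"
      by (auto intro!: derivative_eq_intros)
    ultimately show ?thesis by (rule has_derivative_mult)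
  qed
  \<comment> \<open>The derivative of the i-th coordinate of g(|x|) \<psi>(x) x. Only the direction
    v = i is integrated, and summing over i gives the full divergence.\<close>
  define w' where "w' i x v = g (norm x) * (x \<bullet> i) * (v \<bullet> grad \<psi> x)
      + (g (norm x) * (v \<bullet> i) + A x * (v \<bullet> x) * (x \<bullet> i)) * \<psi> x" for i x v :: 'a
  have w_der: "((\<lambda>x. g (norm x) * (x \<bullet> i) * \<psi> x) has_derivative w' i x) (at x)" for i x
    unfolding w'_def by (intro has_derivative_mult V_der grad_works \<psi>)
  have \<psi>_cont: "continuous_on UNIV \<psi>"
    using \<psi>(1) by (auto intro!: continuous_at_imp_continuous_on differentiable_imp_continuous_within)
  have "\<exists>K. \<forall>x. \<bar>w' i x i\<bar> \<le> K" if i: "i \<in> Basis" for i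
  proof -
    have "compact (b ` {0..R})" "compact (\<psi> ` cball 0 R)" "compact (grad \<psi> ` cball 0 R)"
      by (intro compact_continuous_image compact_Icc compact_cball continuous_on_subset[OF b(1)]
          continuous_on_subset[OF \<psi>_cont] continuous_on_subset[OF \<psi>(2)]; auto)+
    then obtain B1 B2 B3 where B: "\<forall>y\<in>b ` {0..R}. norm y \<le> B1" "\<forall>y\<in>\<psi> ` cball 0 R. norm y \<le> B2"
        "\<forall>y\<in>grad \<psi> ` cball 0 R. norm y \<le> B3"
      using compact_imp_bounded bounded_iff by metis
    have "\<bar>w' i x i\<bar> \<le> \<bar>B1\<bar> * R * \<bar>B3\<bar> + (\<bar>B1\<bar> + (\<bar>B1\<bar> + N * \<bar>B1\<bar>)) * \<bar>B2\<bar>" if x: "norm x \<le> R" for x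
    proof -
      have R: "0 \<le> R" using x norm_ge_zero[of x] by linarith
      have bB: "\<bar>b r\<bar> \<le> \<bar>B1\<bar>" if "0 \<le> r" "r \<le> R" for r using B(1) that by force
      have gB: "\<bar>g r\<bar> \<le> \<bar>B1\<bar>" if r: "0 \<le> r" "r \<le> R" for r
      proof (cases "r = 0")
        case True
        have "\<bar>b 0\<bar> / N \<le> \<bar>b 0\<bar> / 1" using N by (intro divide_left_mono) auto
        then show ?thesis using True bB[of 0] R N by (simp add: g_def)
      next
        case False
        have "radial_mean n b r \<le> integral {0..r} (\<lambda>_. \<bar>B1\<bar>)"
          using bB r b by (intro radial_mean_le_integral) force+
        then show ?thesis
          using False r radial_mean_nonneg[OF b, of r n] by (simp add: g_def field_simps)
      qed
      have xi: "\<bar>x \<bullet> i\<bar> \<le> norm x" using i by (rule Basis_le_norm)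
      \<comment> \<open>\<open>A\<close> itself may blow up at the origin, but it occurs only with
        (x \<bullet> i)^2 \<le> |x|^2, and A |x|^2 is b - N g, which is bounded.\<close>
      have "\<bar>A x * (i \<bullet> x) * (x \<bullet> i)\<bar> \<le> \<bar>B1\<bar> + N * \<bar>B1\<bar>"
      proof (cases "x = 0")
        case False
        have "(x \<bullet> i)\<^sup>2 \<le> (norm x)\<^sup>2" using power_mono[OF xi, of 2] by simp
        then have "\<bar>A x\<bar> * (x \<bullet> i)\<^sup>2 \<le> \<bar>A x\<bar> * (norm x)\<^sup>2" by (intro mult_left_mono) auto
        also have "\<dots> = \<bar>b (norm x) - N * g (norm x)\<bar>" using False by (simp add: A_def)
        also have "\<dots> \<le> \<bar>b (norm x)\<bar> + N * \<bar>g (norm x)\<bar>" using N by (simp add: abs_mult abs_triangle_ineq4[THEN order_trans])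
        also have "\<dots> \<le> \<bar>B1\<bar> + N * \<bar>B1\<bar>" using bB[of "norm x"] gB[of "norm x"] x N by (intro add_mono mult_left_mono) auto
        finally show ?thesis by (simp add: abs_mult power2_eq_square inner_commute)
      qed (use N in \<open>simp add: A_def\<close>)
      moreover have "\<bar>g (norm x) * (i \<bullet> i)\<bar> \<le> \<bar>B1\<bar>" using gB[of "norm x"] x i by simp
      ultimately have "\<bar>g (norm x) * (i \<bullet> i) + A x * (i \<bullet> x) * (x \<bullet> i)\<bar> \<le> \<bar>B1\<bar> + (\<bar>B1\<bar> + N * \<bar>B1\<bar>)" by linarith
      moreover have "\<bar>\<psi> x\<bar> \<le> \<bar>B2\<bar>" using B(2) x by force
      ultimately have 1: "\<bar>(g (norm x) * (i \<bullet> i) + A x * (i \<bullet> x) * (x \<bullet> i)) * \<psi> x\<bar> \<le> (\<bar>B1\<bar> + (\<bar>B1\<bar> + N * \<bar>B1\<bar>)) * \<bar>B2\<bar>"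
        unfolding abs_mult[of _ "\<psi> x"] using N by (intro mult_mono) auto
      have "norm (grad \<psi> x) \<le> \<bar>B3\<bar>" using B(3) x by force
      then have "\<bar>i \<bullet> grad \<psi> x\<bar> \<le> \<bar>B3\<bar>" using Basis_le_norm[OF i, of "grad \<psi> x"] by (simp add: inner_commute)
      then have "\<bar>g (norm x) * (x \<bullet> i) * (i \<bullet> grad \<psi> x)\<bar> \<le> \<bar>B1\<bar> * R * \<bar>B3\<bar>"
        unfolding abs_mult using gB[of "norm x"] xi x R by (intro mult_mono) auto
      then show ?thesis using 1 unfolding w'_def by linarith
    qed
    moreover have "w' i x i = 0" if "R < norm x" for x
      using supp[OF that] grad_eq_0_outside[of R \<psi> x, OF supp that] by (simp add: w'_def)
    ultimately have "\<bar>w' i x i\<bar> \<le> \<bar>\<bar>B1\<bar> * R * \<bar>B3\<bar> + (\<bar>B1\<bar> + (\<bar>B1\<bar> + N * \<bar>B1\<bar>)) * \<bar>B2\<bar>\<bar>" for x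
      by (cases "R < norm x") (simp, meson abs_ge_self not_le order_trans)
    then show ?thesis by blast
  qed
  then obtain K where K: "\<And>i x. i \<in> Basis \<Longrightarrow> \<bar>w' i x i\<bar> \<le> K i" by metis
  have supp': "g (norm x) * (x \<bullet> i) * \<psi> x = 0" if "R < norm x" for x i using supp that by simp
  note int = integrable_directional_derivative[OF w_der K supp']
    and int0 = integral_directional_derivative_eq_0[OF w_der K supp']
  have sum: "(\<Sum>i\<in>Basis. w' i x i) = ((radial_mean n b (norm x) / norm x) *\<^sub>R x) \<bullet> grad \<psi> x + b (norm x) * \<psi> x" for x
  proof -
    have "(\<Sum>i\<in>Basis. w' i x i) = g (norm x) * (\<Sum>i\<in>Basis. (x \<bullet> i) * (grad \<psi> x \<bullet> i))
        + (g (norm x) * (\<Sum>i\<in>(Basis::'a set). 1) + A x * (\<Sum>i\<in>Basis. (x \<bullet> i) * (x \<bullet> i))) * \<psi> x"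
      by (simp add: w'_def sum.distrib sum_distrib_left sum_distrib_right inner_commute algebra_simps del: sum_constant)
    also have "\<dots> = g (norm x) * (x \<bullet> grad \<psi> x) + (g (norm x) * N + A x * (norm x)\<^sup>2) * \<psi> x"
      by (simp add: euclidean_inner[symmetric] dim N_def power2_norm_eq_inner)
    also have "g (norm x) * N + A x * (norm x)\<^sup>2 = b (norm x)"
      using N by (simp add: A_def g_def)
    also have "g (norm x) * (x \<bullet> grad \<psi> x) = ((radial_mean n b (norm x) / norm x) *\<^sub>R x) \<bullet> grad \<psi> x"
      by (cases "x = 0") (simp_all add: g_def)
    finally show ?thesis .
  qed
  have "integrable lborel (\<lambda>x. b (norm x) * \<psi> x)"
    using supp by (intro integrable_compact_support[of _ R] continuous_intros continuous_on_norm_compose b \<psi>_cont) auto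
  moreover have "integrable lborel (\<lambda>x. (\<Sum>i\<in>Basis. w' i x i))"
    by (intro Bochner_Integration.integrable_sum int)
  moreover have "(LINT x|lborel. (\<Sum>i\<in>Basis. w' i x i)) = 0"
    using int int0 by (subst Bochner_Integration.integral_sum) auto
  ultimately have "(LINT x|lborel. (\<Sum>i\<in>Basis. w' i x i) - b (norm x) * \<psi> x) = - (LINT x|lborel. b (norm x) * \<psi> x)"
    by (subst Bochner_Integration.integral_diff) auto
  then show ?thesis by (simp add: sum)
qed

section \<open>Weak radial solutions\<close>

lemma continuous_nonneg_integral_eq_0:
  fixes f :: "'a::euclidean_space \<Rightarrow> real"
  assumes cont: "continuous_on UNIV f" and nn: "\<And>x. 0 \<le> f x"
    and int: "integrable lborel f" "integral\<^sup>L lborel f = 0"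
  shows "f x = 0"
proof (rule ccontr)
  assume "f x \<noteq> 0"
  define S where "S = {x. f x \<noteq> 0}"
  have "AE x in lborel. f x = 0"
    using int nn by (subst (asm) integral_nonneg_eq_0_iff_AE) auto
  moreover have S: "open S" unfolding S_def by (intro open_Collect_neq cont continuous_on_const)
  ultimately have "S \<in> null_sets lborel"
    unfolding S_def by (subst (asm) AE_iff_null) auto
  then have "negligible S" using null_sets_completionI negligible_iff_null_sets by blast
  then show False using open_not_negligible[OF S] \<open>f x \<noteq> 0\<close> by (auto simp: S_def)
qed

context radial_problem begin

lemma source_0 [simp]: "source u 0 = 0" by (simp add: source_def)

lemma profile_imp_solution:
  assumes dim: "DIM('a::euclidean_space) = Suc n"
    and u: "\<And>r. 0 \<le> r \<Longrightarrow> (u has_real_derivative h_inv \<phi> (source u r)) (at r within {0..})"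
    and pos: "\<And>r. 0 \<le> r \<Longrightarrow> 0 < u r"
  shows profile_imp_Ck_1: "Ck 1 (\<lambda>x::'a. u (norm x))"
    and profile_imp_weak_solution: "weak_solution \<phi> (\<lambda>x. a0 (norm x)) f (\<lambda>x::'a. u (norm x))"
proof -
  define U where "U x = u (norm x)" for x :: 'a
  define d where "d r = h_inv \<phi> (source u r)" for r
  have u_cont: "continuous_on {0..} u" using profile_continuous[OF u pos] .
  have u_nn: "0 \<le> u r" if "0 \<le> r" for r using pos[OF that] by simp
  have d_cont: "continuous_on {0..} d" unfolding d_def by (intro slope_continuous u_cont u_nn)
  have d0: "d 0 = 0" by (simp add: d_def)
  have src: "0 \<le> source u r" if "0 \<le> r" for r using profile_source_nonneg[OF u pos that] .
  have der: "(U has_derivative (\<lambda>v. v \<bullet> ((d (norm x) / norm x) *\<^sub>R x))) (at x)" for x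
    unfolding U_def using u[of "norm x"] d0 by (intro has_derivative_radial) (auto simp: d_def)
  then have grad: "grad U = (\<lambda>x. (d (norm x) / norm x) *\<^sub>R x)" using grad_eqI by blast
  show "Ck 1 (\<lambda>x::'a. u (norm x))"
    unfolding U_def[symmetric] Ck_1_iff grad
    using der continuous_on_radial_field[OF d_cont d0] by (auto simp: differentiable_def)
  \<comment> \<open>Taking the norm of the gradient loses no sign because the slope is non-negative,
    and \<open>h\<close> undoes \<open>h_inv\<close>.\<close>
  have field: "\<phi> (norm (grad U x)) *\<^sub>R grad U x = (source u (norm x) / norm x) *\<^sub>R x" for x
  proof (cases "x = 0")
    case False
    have dn: "0 \<le> d (norm x)" using h_inv_nonneg src by (simp add: d_def)
    have "h (d (norm x)) = source u (norm x)" using h_h_inv src by (simp add: d_def)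
    then have "\<phi> (d (norm x)) * d (norm x) = source u (norm x)" by (simp add: h_def)
    then show ?thesis using False dn by (simp add: grad)
  qed (simp add: grad)
  show "weak_solution \<phi> (\<lambda>x. a0 (norm x)) f (\<lambda>x::'a. u (norm x))"
    unfolding weak_solution_def U_def[symmetric]
  proof (intro allI impI)
    fix \<psi> :: "'a \<Rightarrow> real" assume \<psi>: "test_function \<psi>"
    then have "Ck 1 \<psi>" by (simp add: test_function_def del: Ck.simps)
    moreover obtain R where "\<And>x. R < norm x \<Longrightarrow> \<psi> x = 0" using test_function_support[OF \<psi>] by blast
    ultimately have "(LINT x|lborel. ((radial_mean n (\<lambda>t. a0 t * f (u t)) (norm x) / norm x) *\<^sub>R x) \<bullet> grad \<psi> x)
        = - (LINT x|lborel. a0 (norm x) * f (u (norm x)) * \<psi> x)"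
      unfolding Ck_1_iff using a0_nonneg f_nonneg u_nn
      by (intro radial_divergence[OF dim] a0_f_continuous u_cont) auto
    then show "(LINT x|lborel. (\<phi> (norm (grad U x)) *\<^sub>R grad U x) \<bullet> grad \<psi> x)
        + (LINT x|lborel. a0 (norm x) * f (U x) * \<psi> x) = 0"
      by (simp only: field source_def U_def)
  qed
qed

text \<open>Both \<open>\<phi>(|\<nabla>u|)\<nabla>u\<close> and the field of \<open>radial_divergence\<close> have the same weak divergence; testing their
  difference, a radial field, with radial bumps concentrated near a sphere shows that it vanishes.\<close>

lemma solution_imp_profile:
  assumes dim: "DIM('a::euclidean_space) = Suc n"
    and C1: "Ck 1 (\<lambda>x::'a. u (norm x))" and pos: "\<And>r. 0 \<le> r \<Longrightarrow> 0 < u r"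
    and weak: "weak_solution \<phi> (\<lambda>x. a0 (norm x)) f (\<lambda>x::'a. u (norm x))"
    and r: "0 \<le> r"
  shows "(u has_real_derivative h_inv \<phi> (source u r)) (at r within {0..})"
proof -
  define U where "U x = u (norm x)" for x :: 'a
  obtain e :: 'a where e: "e \<in> Basis" using nonempty_Basis by blast
  have ne: "norm e = 1" using e by simp
  have U_diff: "U differentiable (at x)" for x
    using C1 unfolding U_def[symmetric] Ck_1_iff by blast
  have G_cont: "continuous_on UNIV (grad U)"
    using C1 unfolding U_def[symmetric] Ck_1_iff by blast
  \<comment> \<open>The derivative along a fixed ray. As a component of the continuous gradient it
    is continuous, and on the half-line it is the derivative of \<open>u\<close>.\<close>
  define d where "d r = grad U (r *\<^sub>R e) \<bullet> e" for r
  have line: "DERIV (\<lambda>r. U (r *\<^sub>R e)) r :> d r" for r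
  proof -
    have "((\<lambda>s. s *\<^sub>R e) has_derivative (\<lambda>s. s *\<^sub>R e)) (at r)"
      by (auto intro!: derivative_eq_intros)
    from has_derivative_compose[OF this grad_works[OF U_diff]]
    show ?thesis by (simp add: has_field_derivative_def d_def inner_commute mult_commute_abs)
  qed
  have u_der: "(u has_real_derivative d r) (at r within {0..})" if "0 \<le> r" for r
    by (rule has_field_derivative_transform_within[OF has_field_derivative_at_within[OF line], of 1])
       (use that ne in \<open>auto simp: U_def\<close>)
  \<comment> \<open>Restricted to the line through the origin, \<open>U\<close> is even.\<close>
  have d0: "d 0 = 0"
  proof -
    have "DERIV (\<lambda>r. U (- r *\<^sub>R e)) 0 :> - d 0"
      using line[of 0] DERIV_mirror[of "\<lambda>r. U (r *\<^sub>R e)" "d 0" 0] by simp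
    moreover have "(\<lambda>r. U (- r *\<^sub>R e)) = (\<lambda>r. U (r *\<^sub>R e))" by (simp add: U_def fun_eq_iff)
    ultimately have "- d 0 = d 0" using line[of 0] DERIV_unique by metis
    then show ?thesis by simp
  qed
  have d_cont: "continuous_on {0..} d"
    unfolding d_def by (intro continuous_intros continuous_on_compose2[OF G_cont]) auto
  have u_cont: "continuous_on {0..} u"
    using u_der by (rule has_real_derivative_imp_continuous_on_atLeast)
  have u_nn: "0 \<le> u r" if "0 \<le> r" for r using pos[OF that] by simp
  have "(U has_derivative (\<lambda>v. v \<bullet> ((d (norm x) / norm x) *\<^sub>R x))) (at x)" for x
    unfolding U_def using u_der[of "norm x"] d0 by (intro has_derivative_radial) auto
  then have grad: "grad U = (\<lambda>x. (d (norm x) / norm x) *\<^sub>R x)" using grad_eqI by blast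
  \<comment> \<open>The odd extension of \<open>h\<close>. The sign of the slope of a given solution
    is not known yet, so the flux has to make sense for negative slopes too.\<close>
  define k where "k z = h (max z 0) - h (max (- z) 0)" for z
  have k_cont: "continuous_on UNIV k" unfolding k_def
    by (intro continuous_intros continuous_on_compose2[OF h_continuous]) auto
  have k_eq: "k z = \<phi> \<bar>z\<bar> * z" for z by (cases "0 \<le> z") (auto simp: k_def h_def max_def)
  define b where "b t = a0 t * f (u t)" for t
  have b_cont: "continuous_on {0..} b" and b_nn: "\<And>t. 0 \<le> t \<Longrightarrow> 0 \<le> b t"
    unfolding b_def using a0_f_continuous[OF u_cont u_nn] a0_nonneg f_nonneg u_nn by auto
  have src_cont: "continuous_on {0..} (source u)" unfolding source_def b_def[symmetric]
    using b_cont b_nn by (rule radial_mean_continuous)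
  \<comment> \<open>The defect between the actual flux and the one prescribed by the integral
    equation; the claim amounts to W = 0 on (0, \<infinity>).\<close>
  define W where "W r = k (d r) - source u r" for r
  have kd_cont: "continuous_on {0..} (\<lambda>r. k (d r))"
    by (rule continuous_on_compose2[OF k_cont d_cont]) auto
  have W_cont: "continuous_on {0..} W"
    unfolding W_def by (intro continuous_intros kd_cont src_cont)
  have test: "(LINT x|lborel. 2 * bump \<alpha> \<beta> (x \<bullet> x) * (W (norm x) * norm (x::'a))) = 0"
    and test_int: "integrable lborel (\<lambda>x::'a. 2 * bump \<alpha> \<beta> (x \<bullet> x) * (W (norm x) * norm x))" for \<alpha> \<beta>
  proof -
    obtain \<psi> :: "'a \<Rightarrow> real" where \<psi>: "test_function \<psi>" "\<And>x. grad \<psi> x = (2 * bump \<alpha> \<beta> (x \<bullet> x)) *\<^sub>R x"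
      using radial_test_function by blast
    obtain R where R: "\<And>x. R < norm x \<Longrightarrow> \<psi> x = 0" using test_function_support[OF \<psi>(1)] by blast
    have \<psi>1: "Ck 1 \<psi>" using \<psi>(1) by (simp add: test_function_def del: Ck.simps)
    then have \<psi>_diff: "\<And>x. \<psi> differentiable (at x)" and grad_cont: "continuous_on UNIV (grad \<psi>)"
      unfolding Ck_1_iff by auto
    define X Y where "X x = ((k (d (norm x)) / norm x) *\<^sub>R x) \<bullet> grad \<psi> x"
      and "Y x = ((source u (norm x) / norm x) *\<^sub>R x) \<bullet> grad \<psi> x" for x
    have supp: "grad \<psi> x = 0" if "R < norm x" for x
      by (rule grad_eq_0_outside[OF R that])
    have "integrable lborel X"
      unfolding X_def
    proof (rule integrable_compact_support[of _ R])
      show "continuous_on UNIV (\<lambda>x. ((k (d (norm x)) / norm x) *\<^sub>R x) \<bullet> grad \<psi> x)"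
        by (intro continuous_on_inner grad_cont continuous_on_radial_field[of "\<lambda>r. k (d r)"] kd_cont)
           (simp add: d0 k_eq)
    qed (simp add: supp)
    moreover have "integrable lborel Y"
      unfolding Y_def
    proof (rule integrable_compact_support[of _ R])
      show "continuous_on UNIV (\<lambda>x. ((source u (norm x) / norm x) *\<^sub>R x) \<bullet> grad \<psi> x)"
        by (intro continuous_on_inner grad_cont continuous_on_radial_field src_cont source_0)
    qed (simp add: supp)
    moreover have "integral\<^sup>L lborel X = integral\<^sup>L lborel Y"
    proof -
      have "\<phi> (norm (grad U x)) *\<^sub>R grad U x = (k (d (norm x)) / norm x) *\<^sub>R x" for x
        by (cases "x = 0") (simp_all add: grad k_eq)
      then have "integral\<^sup>L lborel X + (LINT x|lborel. b (norm x) * \<psi> x) = 0"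
        using weak \<psi>(1) unfolding weak_solution_def U_def[symmetric] X_def b_def by (simp add: U_def)
      moreover have "integral\<^sup>L lborel Y = - (LINT x|lborel. b (norm x) * \<psi> x)"
        unfolding Y_def source_def b_def[symmetric]
        by (rule radial_divergence[OF dim b_cont b_nn \<psi>_diff grad_cont R])
      ultimately show ?thesis by simp
    qed
    moreover have "X x - Y x = 2 * bump \<alpha> \<beta> (x \<bullet> x) * (W (norm x) * norm x)" for x
    proof (cases "x = 0")
      case False
      then show ?thesis
        by (simp add: X_def Y_def W_def \<psi>(2) dot_square_norm power2_eq_square field_simps)
    qed (simp add: X_def Y_def)
    ultimately show "(LINT x|lborel. 2 * bump \<alpha> \<beta> (x \<bullet> x) * (W (norm x) * norm (x::'a))) = 0"
      and "integrable lborel (\<lambda>x::'a. 2 * bump \<alpha> \<beta> (x \<bullet> x) * (W (norm x) * norm x))"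
      using Bochner_Integration.integral_diff[of lborel X Y] Bochner_Integration.integrable_diff[of lborel X Y]
      by auto
  qed
  have W_eq_0: "W r = 0" if r: "0 < r" for r
  proof (rule ccontr)
    assume W: "W r \<noteq> 0"
    define \<sigma> where "\<sigma> = sgn (W r)"
    have \<sigma>r: "0 < \<sigma> * W r"
      using W by (simp add: \<sigma>_def mult.commute abs_sgn[symmetric])
    have "isCont (\<lambda>r. \<sigma> * W r) r"
      using W_cont r by (intro continuous_intros) (simp add: continuous_on_interior interior_real_atLeast)
    then have "\<forall>\<^sub>F t in at r. 0 < \<sigma> * W t"
      unfolding isCont_def using \<sigma>r by (rule order_tendstoD)
    then obtain \<delta>0 where \<delta>0: "0 < \<delta>0" "\<And>t. t \<noteq> r \<Longrightarrow> dist t r < \<delta>0 \<Longrightarrow> 0 < \<sigma> * W t"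
      by (auto simp: eventually_at)
    \<comment> \<open>The bound \<delta> \<le> r keeps r - \<delta> non-negative, so that squaring
      preserves order. The end points are squared because the bump is evaluated at |x|^2.\<close>
    define \<delta> where "\<delta> = min \<delta>0 r"
    have \<delta>: "0 < \<delta>" "\<delta> \<le> r" using \<delta>0 r by (auto simp: \<delta>_def)
    have \<sigma>W: "0 < \<sigma> * W t" if "\<bar>t - r\<bar> < \<delta>" for t
      using that \<delta>0(2)[of t] \<sigma>r by (cases "t = r") (auto simp: \<delta>_def dist_real_def)
    define \<alpha> \<beta> where "\<alpha> = (r - \<delta>)\<^sup>2" and "\<beta> = (r + \<delta>)\<^sup>2"
    have near: "\<bar>t - r\<bar> < \<delta>" if "\<alpha> < t\<^sup>2" "t\<^sup>2 < \<beta>" "0 \<le> t" for t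
      using that \<delta> r power2_less_imp_less[of "r - \<delta>" t] power2_less_imp_less[of t "r + \<delta>"]
      by (auto simp: \<alpha>_def \<beta>_def)
    define J where "J x = \<sigma> * (2 * bump \<alpha> \<beta> (x \<bullet> x) * (W (norm x) * norm x))" for x :: 'a
    have "J (r *\<^sub>R e) = 0"
    proof (rule continuous_nonneg_integral_eq_0[of J])
      have "continuous_on UNIV (\<lambda>x::'a. bump \<alpha> \<beta> (x \<bullet> x))"
        using Ck_compose[OF Ck_bump Ck_inner_self, of 0] by simp
      then show "continuous_on UNIV J"
        unfolding J_def
        by (intro continuous_on_mult continuous_on_const continuous_on_norm_compose[OF W_cont]
            continuous_on_norm_id)
      show "0 \<le> J x" for x
      proof (cases "\<alpha> < (norm x)\<^sup>2 \<and> (norm x)\<^sup>2 < \<beta>")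
        case True
        then have "0 \<le> \<sigma> * W (norm x)" using \<sigma>W[OF near, of "norm x"] by simp
        then have "0 \<le> 2 * bump \<alpha> \<beta> (x \<bullet> x) * norm x * (\<sigma> * W (norm x))"
          using bump_nonneg by (intro mult_nonneg_nonneg[of _ "\<sigma> * W (norm x)"]) auto
        then show ?thesis by (simp add: J_def mult_ac)
      next
        case False
        then show ?thesis using bump_eq_0[of \<alpha> "x \<bullet> x" \<beta>] by (simp add: J_def dot_square_norm)
      qed
      show "integrable lborel J" unfolding J_def by (intro integrable_mult_right test_int)
      show "integral\<^sup>L lborel J = 0" unfolding J_def using test by simp
    qed
    moreover have "\<alpha> < r\<^sup>2" "r\<^sup>2 < \<beta>"
      unfolding \<alpha>_def \<beta>_def using \<delta> r by (auto intro!: power_strict_mono)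
    then have "0 < bump \<alpha> \<beta> (r\<^sup>2)" by (simp add: bump_pos_iff)
    moreover have "(r *\<^sub>R e) \<bullet> (r *\<^sub>R e) = r\<^sup>2" using ne by (simp add: dot_square_norm)
    ultimately show False using W r ne by (simp add: J_def \<sigma>_def sgn_0_0)
  qed
  have "d r = h_inv \<phi> (source u r)"
  proof (cases "r = 0")
    case False
    then have eq: "k (d r) = source u r" using W_eq_0[of r] r by (simp add: W_def)
    have nn: "0 \<le> source u r" using source_nonneg[OF u_cont u_nn r] .
    \<comment> \<open>Only now is the sign of the slope settled: \<open>k\<close> preserves signs,
      and the prescribed flux is non-negative.\<close>
    have "0 \<le> d r"
    proof (rule ccontr)
      assume "\<not> 0 \<le> d r"
      then have "k (d r) < 0" using phi_pos[of "\<bar>d r\<bar>"] by (simp add: k_eq mult_pos_neg)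
      then show False using eq nn by simp
    qed
    then have "h (d r) = source u r" using eq by (simp add: k_eq h_def)
    then show ?thesis using h_inv_h[OF \<open>0 \<le> d r\<close>] by simp
  qed (simp add: d0)
  then show ?thesis using u_der[OF r] by simp
qed

section \<open>Consequences of the divergence hypothesis on a\<close>

lemma slope_a0_continuous: "continuous_on {0..} (\<lambda>s. h_inv \<phi> (radial_mean n a0 s))"
  by (rule continuous_on_compose2[OF h_inv_continuous radial_mean_continuous[OF a0_continuous a0_nonneg]])
     (auto intro: radial_mean_nonneg[OF a0_continuous a0_nonneg])

text \<open>Otherwise \<open>a0\<close> would vanish on (0, \<infinity>), its value at 0 would not
  affect the integrals, and the integrand of the divergent integral would be 0.\<close>

lemma a0_pos_exists:
  assumes "\<And>B. \<exists>x\<ge>1. B < integral {1..x} (\<lambda>s. h_inv \<phi> (radial_mean n a0 s))"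
  obtains r where "0 < r" "0 < a0 r"
proof -
  have "\<exists>r>0. 0 < a0 r"
  proof (rule ccontr)
    assume no: "\<not> ?thesis"
    have a00: "a0 r = 0" if "0 < r" for r using that no a0_nonneg[of r] by force
    have "radial_mean n a0 s = 0" for s
    proof -
      have "integral {0..s} (\<lambda>t. t ^ n * a0 t) = integral {0..s} (\<lambda>t. 0)"
        by (rule integral_spike[of "{0}"]) (auto simp: a00)
      then show ?thesis by (simp add: radial_mean_def)
    qed
    then show False using assms[of 0] by simp
  qed
  then show ?thesis using that by blast
qed

lemma profile_at_top:
  assumes div: "\<And>B. \<exists>x\<ge>1. B < integral {1..x} (\<lambda>s. h_inv \<phi> (radial_mean n a0 s))"
    and u: "\<And>r. 0 \<le> r \<Longrightarrow> (u has_real_derivative h_inv \<phi> (source u r)) (at r within {0..})"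
    and pos: "\<And>r. 0 \<le> r \<Longrightarrow> 0 < u r"
  shows "filterlim u at_top at_top"
  unfolding filterlim_at_top
proof
  fix Z
  note cont = profile_continuous[OF u pos] and mono = profile_mono[OF u pos]
  \<comment> \<open>Since u \<ge> u(0), the flux is at least f(u(0)) times the mean of
    \<open>a0\<close>. Capping the factor at 1 lets \<open>h_inv_scale\<close> extract it, so
    \<open>u\<close> grows at least like a fixed multiple of the divergent integral.\<close>
  define c where "c = min 1 (f (u 0))"
  have c: "0 < c" "c \<le> 1" using f_pos[OF pos, of 0] by (auto simp: c_def)
  define c' where "c' = c powr (1 / l1)"
  have c': "0 < c'" using c by (simp add: c'_def)
  define I where "I x = integral {1..x} (\<lambda>s. h_inv \<phi> (radial_mean n a0 s))" for x
  have sc: "continuous_on {1..} (\<lambda>s. h_inv \<phi> (radial_mean n a0 s))"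
    by (rule continuous_on_subset[OF slope_a0_continuous]) auto
  have slope: "c' * h_inv \<phi> (radial_mean n a0 s) \<le> h_inv \<phi> (source u s)" if s: "0 \<le> s" for s
  proof -
    have rm: "0 \<le> radial_mean n a0 s" using radial_mean_nonneg[OF a0_continuous a0_nonneg s] .
    have "c' * h_inv \<phi> (radial_mean n a0 s) \<le> h_inv \<phi> (c * radial_mean n a0 s)"
      unfolding c'_def using c rm by (intro h_inv_scale)
    also have "\<dots> \<le> h_inv \<phi> (source u s)"
    proof (rule h_inv_mono)
      have "c * radial_mean n a0 s = radial_mean n (\<lambda>t. c * a0 t) s"
        by (simp add: radial_mean_def mult.left_commute[of _ c])
      also have "\<dots> \<le> source u s"
        unfolding source_def
      proof (intro radial_mean_mono a0_f_continuous cont s continuous_intros a0_continuous)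
        fix t assume t: "0 \<le> t" "t \<le> s"
        have "c \<le> f (u t)" using f_mono[of "u 0" "u t"] mono[of 0 t] t pos[of 0] by (simp add: c_def)
        then have "c * a0 t \<le> f (u t) * a0 t" using a0_nonneg[OF t(1)] by (intro mult_right_mono) auto
        then show "c * a0 t \<le> a0 t * f (u t)" by (simp add: mult.commute)
      qed (use pos in \<open>auto simp: less_imp_le\<close>)
      finally show "c * radial_mean n a0 s \<le> source u s" .
    qed (use c rm in auto)
    finally show ?thesis .
  qed
  have grow: "u 1 + c' * I x \<le> u x" if x: "1 \<le> x" for x
  proof -
    have "u 1 - c' * I 1 \<le> u x - c' * I x"
    proof (rule DERIV_nonneg_imp_increasing_open[OF x])
      have I_cont: "continuous_on {1..} I" unfolding I_def
        by (rule has_real_derivative_imp_continuous_on_atLeast[OF integral_DERIV_atLeast[OF sc]])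
      show "continuous_on {1..x} (\<lambda>s. u s - c' * I s)"
        by (intro continuous_on_diff continuous_on_mult continuous_on_const
            continuous_on_subset[OF cont] continuous_on_subset[OF I_cont]) auto
      fix s assume s: "1 < s" "s < x"
      have "DERIV I s :> h_inv \<phi> (radial_mean n a0 s)"
        unfolding I_def using s
        by (intro has_real_derivative_atLeast_interior[OF integral_DERIV_atLeast[OF sc]]) auto
      moreover have "DERIV u s :> h_inv \<phi> (source u s)"
        using s by (intro has_real_derivative_atLeast_interior[OF u]) auto
      ultimately have "DERIV (\<lambda>s. u s - c' * I s) s :> h_inv \<phi> (source u s) - c' * h_inv \<phi> (radial_mean n a0 s)"
        by (intro DERIV_diff DERIV_cmult)
      then show "\<exists>y. DERIV (\<lambda>s. u s - c' * I s) s :> y \<and> 0 \<le> y"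
        using slope[of s] s by (intro exI conjI) auto
    qed
    then show ?thesis by (simp add: I_def)
  qed
  obtain x where x: "1 \<le> x" "Z / c' < I x" using div unfolding I_def by blast
  have "Z \<le> u y" if "x \<le> y" for y
  proof -
    have "Z < c' * I x" using x c' by (simp add: field_simps)
    also have "\<dots> \<le> u x" using grow[OF x(1)] pos[of 1] by simp
    also have "\<dots> \<le> u y" using mono[of x y] x that by simp
    finally show ?thesis by simp
  qed
  then show "\<forall>\<^sub>F y in at_top. Z \<le> u y" unfolding eventually_at_top_linorder by blast
qed

end

theorem corollary1p2:
  fixes \<phi> f a0 :: "real \<Rightarrow> real"
    and a :: "real ^ 'n \<Rightarrow> real"
    and l m l1 m1 :: real
  assumes phi_C1: "\<phi> C1_differentiable_on {0<..}"
    and phi_pos: "\<forall>t>0. \<phi> t > 0"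
    and phi_deriv: "\<forall>t>0. deriv (\<lambda>s. \<phi> s * s) t > 0"
    and lm: "l > 1" "m > 1"
      "\<forall>t>0. l \<le> \<phi> t * t\<^sup>2 / Phi \<phi> t \<and> \<phi> t * t\<^sup>2 / Phi \<phi> t \<le> m"
    and l1m1: "l1 > 0" "m1 > 0"
      "\<forall>t>0. l1 \<le> deriv (deriv (Phi \<phi>)) t * t / deriv (Phi \<phi>) t \<and>
             deriv (deriv (Phi \<phi>)) t * t / deriv (Phi \<phi>) t \<le> m1"
    and a_cont: "continuous_on UNIV a"
    and a_nonneg: "\<forall>x. a x \<ge> 0"
    and a_radial: "\<forall>x. a x = a0 (norm x)"
    and a_div: "(\<integral>\<^sup>+ s\<in>{1..}. ennreal (h_inv \<phi> (s powi (1 - int CARD('n)) *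
                   integral {0..s} (\<lambda>t. t ^ (CARD('n) - 1) * a0 t))) \<partial>lborel) = \<infinity>"
    and f_cont: "continuous_on {0..} f"
    and f_mono: "mono_on {0..} f"
    and f_zero: "f 0 = 0"
    and f_pos: "\<forall>s>0. f s > 0"
  shows "((\<exists>u. radial_solution_sequence \<phi> a f u) \<longleftrightarrow>
           (\<integral>\<^sup>+ t\<in>{1..}. ennreal (1 / Phi_inv \<phi> (integral {0..t} f)) \<partial>lborel) = \<infinity>)
       \<and> (\<forall>u. radial_solution_sequence \<phi> a f u \<longrightarrow>
           (\<forall>k. \<forall>r\<ge>0. \<exists>d\<ge>0. (u k has_real_derivative d) (at r within {0..})))"
proof -
  define n where "n = CARD('n) - 1"
  have dim: "DIM(real ^ 'n) = Suc n" and card: "CARD('n) = Suc n"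
    by (auto simp: n_def)
  obtain e :: "real ^ 'n" where e: "e \<in> Basis" using nonempty_Basis by blast
  have norm_e: "norm (r *\<^sub>R e) = r" if "0 \<le> r" for r using e that by simp
  have a_eq: "a = (\<lambda>x. a0 (norm x))" using a_radial by auto
  \<comment> \<open>The profile \<open>a0\<close> is only tied to \<open>a\<close> on the half-line;
    its continuity there is recovered by restricting \<open>a\<close> to a ray.\<close>
  have a0_eq: "a0 r = a (r *\<^sub>R e)" if "0 \<le> r" for r using a_radial norm_e[OF that] by simp
  have "continuous_on {0..} (\<lambda>r. a (r *\<^sub>R e))"
    by (rule continuous_on_compose2[OF a_cont]) (auto intro!: continuous_intros)
  then have a0_cont: "continuous_on {0..} a0"
    by (rule continuous_on_eq) (simp add: a0_eq)
  have a0_nn: "0 \<le> a0 r" if "0 \<le> r" for r using a0_eq[OF that] a_nonneg by simp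
  interpret radial_problem \<phi> l m l1 a0 f n
    by unfold_locales
       (use phi_C1 phi_pos phi_deriv lm l1m1 a0_cont a0_nn f_cont f_mono f_zero f_pos in auto)
  have "(\<integral>\<^sup>+ s\<in>{1..}. ennreal (h_inv \<phi> (radial_mean n a0 s)) \<partial>lborel) = \<infinity>"
  proof -
    have "s powi (1 - int CARD('n)) * integral {0..s} (\<lambda>t. t ^ (CARD('n) - 1) * a0 t) = radial_mean n a0 s" for s
      by (simp add: card radial_mean_def power_int_minus divide_inverse mult.commute)
    then show ?thesis using a_div by simp
  qed
  moreover have "continuous_on {1..} (\<lambda>s. h_inv \<phi> (radial_mean n a0 s))"
    by (rule continuous_on_subset[OF slope_a0_continuous]) auto
  ultimately have div: "\<exists>x\<ge>1. B < integral {1..x} (\<lambda>s. h_inv \<phi> (radial_mean n a0 s))" for B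
    using h_inv_nonneg radial_mean_nonneg[OF a0_continuous a0_nonneg]
    by (subst (asm) nn_integral_atLeast_infinite_iff) auto
  have KO_iff: "(\<integral>\<^sup>+ t\<in>{1..}. ennreal (1 / Phi_inv \<phi> (integral {0..t} f)) \<partial>lborel) = \<infinity> \<longleftrightarrow>
      (\<forall>B. \<exists>x\<ge>1. B < integral {1..x} (\<lambda>t. 1 / w t))"
    using nn_integral_atLeast_infinite_iff[OF inverse_w_continuous[of 1]] w_pos
    by (simp add: w_def F_def less_imp_le)
  have profile: "(u k has_real_derivative h_inv \<phi> (source (u k) r)) (at r within {0..})"
    and profile_pos: "0 < u k r"
    if u: "radial_solution_sequence \<phi> a f u" and r: "0 \<le> r" for u k r
  proof -
    have sol: "solution \<phi> a f (\<lambda>x. u k (norm x))" using u by (simp add: radial_solution_sequence_def)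
    have pos: "0 < u k s" if "0 \<le> s" for s
      using sol norm_e[OF that] unfolding solution_def by metis
    then show "0 < u k r" using r .
    show "(u k has_real_derivative h_inv \<phi> (source (u k) r)) (at r within {0..})"
      using sol unfolding solution_def a_eq by (intro solution_imp_profile[OF dim _ pos _ r]) auto
  qed
  have exists: "\<exists>u. radial_solution_sequence \<phi> a f u"
    if KO: "\<And>B. \<exists>x\<ge>1. B < integral {1..x} (\<lambda>t. 1 / w t)"
  proof -
    \<comment> \<open>The initial values k + 1 are positive already for k = 0 and tend to
      infinity.\<close>
    have "\<forall>k. \<exists>u. u 0 = real k + 1 \<and> (\<forall>r\<ge>0. real k + 1 \<le> u r) \<and>
        (\<forall>r\<ge>0. (u has_real_derivative h_inv \<phi> (source u r)) (at r within {0..}))"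
    proof
      fix k
      show "\<exists>u. u 0 = real k + 1 \<and> (\<forall>r\<ge>0. real k + 1 \<le> u r) \<and>
        (\<forall>r\<ge>0. (u has_real_derivative h_inv \<phi> (source u r)) (at r within {0..}))"
        by (rule profile_exists[OF KO, of "real k + 1"]) auto
    qed
    then obtain u where u: "\<And>k. u k 0 = real k + 1" "\<And>k r. 0 \<le> r \<Longrightarrow> real k + 1 \<le> u k r"
      "\<And>k r. 0 \<le> r \<Longrightarrow> (u k has_real_derivative h_inv \<phi> (source (u k) r)) (at r within {0..})"
      by metis
    have pos: "0 < u k r" if "0 \<le> r" for k r using u(2)[OF that, of k] by simp
    have "solution \<phi> a f (\<lambda>x. u k (norm x))" for k
      unfolding solution_def a_eq
    proof (intro conjI allI)
      show "Ck 1 (\<lambda>x::real ^ 'n. u k (norm x))" by (rule profile_imp_Ck_1[OF dim u(3) pos])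
      show "weak_solution \<phi> (\<lambda>x. a0 (norm x)) f (\<lambda>x::real ^ 'n. u k (norm x))"
        by (rule profile_imp_weak_solution[OF dim u(3) pos])
      show "filterlim (\<lambda>x::real ^ 'n. u k (norm x)) at_top at_infinity"
        by (rule filterlim_compose[OF profile_at_top[OF div u(3) pos] filterlim_norm_at_top])
    qed (simp add: pos)
    moreover have "filterlim (\<lambda>k. u k 0) at_top sequentially"
      unfolding u(1) by (rule filterlim_at_top_mono[OF filterlim_real_sequentially]) simp
    ultimately show ?thesis by (auto simp: radial_solution_sequence_def)
  qed
  have diverges: "\<exists>x\<ge>1. B < integral {1..x} (\<lambda>t. 1 / w t)"
    if u: "radial_solution_sequence \<phi> a f u" for u B
  proof (rule ccontr)
    assume "\<not> ?thesis"
    then have conv: "integral {1..x} (\<lambda>t. 1 / w t) \<le> B" if "1 \<le> x" for x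
      using that by (meson not_le)
    obtain r where "0 < r" "0 < a0 r" using a0_pos_exists[OF div] by blast
    then obtain \<beta> where \<beta>: "\<And>u. (\<And>r. 0 \<le> r \<Longrightarrow> 0 < u r) \<Longrightarrow>
        (\<And>r. 0 \<le> r \<Longrightarrow> (u has_real_derivative h_inv \<phi> (source u r)) (at r within {0..})) \<Longrightarrow> u 0 < \<beta>"
      using profile_initial_bound[OF conv] by metis
    \<comment> \<open>The bound \<beta> was obtained before any solution was chosen, so one value
      serves all k and contradicts the divergence of the initial values.\<close>
    have "u k 0 < \<beta>" for k using \<beta>[OF profile_pos[OF u] profile[OF u]] .
    moreover have "\<forall>\<^sub>F k in sequentially. \<beta> \<le> u k 0"
      using u unfolding radial_solution_sequence_def filterlim_at_top by blast
    ultimately show False using eventually_happens[of "\<lambda>k. \<beta> \<le> u k 0" sequentially] by (auto simp: not_le[symmetric])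
  qed
  \<comment> \<open>This concerns every sequence of solutions, not only the one constructed: each
    member satisfies the integral equation, whose slopes are values of \<open>h_inv\<close> at
    non-negative arguments.\<close>
  have "\<exists>d\<ge>0. (u k has_real_derivative d) (at r within {0..})"
    if u: "radial_solution_sequence \<phi> a f u" and r: "0 \<le> r" for u k r
    using profile[OF u r] h_inv_nonneg profile_source_nonneg[OF profile[OF u] profile_pos[OF u] r] by blast
  then show ?thesis using KO_iff exists diverges by blast
qed

end
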